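(* Let $a,b\in\mathbb{C}$ with $b\neq0$, and let $\alpha,\bar\alpha,\beta\in\mathbb{C}$ with $\alpha,\bar\alpha\neq0$. Consider extensions $0\to M_{\bar\alpha,\beta}\to E\to M_{\alpha,\beta}\to0$ of $\mathcal{W}(a,b)$-modules (so $\bar\beta=\beta$), written as $E=\mathbb{C}[\partial]v_{\bar\alpha}\oplus\mathbb{C}[\partial]v_\alpha$ with $L_\lambda v_\alpha=(\partial+\alpha\lambda+\beta)v_\alpha+f(\partial,\lambda)v_{\bar\alpha}$, $W_\lambda v_\alpha=g(\partial,\lambda)v_{\bar\alpha}$. Then in every such extension $g=0$. A nontrivial such extension exists if and only if one of the following holds, and then every nontrivial extension is equivalent to one with $g=0$ and $f(\partial,\lambda)=F(\partial+\beta,\lambda)$ with $F$ as indicated: (i) $\alpha=\bar\alpha$ and $F(\partial,\lambda)=a_0+a_1\lambda$ with $(a_0,a_1)\neq(0,0)$; (ii) $\alpha-\bar\alpha=2$ and $F=c\,\lambda^2(2\partial+\lambda)$, $c\neq0$; (iii) $\alpha-\bar\alpha=3$ and $F=c\,\partial\lambda^2(\partial+\lambda)$, $c\neq0$; (iv) $\alpha-\bar\alpha=4$ and $F=c\,\lambda^2(4\partial^3+6\partial^2\lambda-\partial\lambda^2+\bar\alpha\lambda^3)$, $c\neq0$; (v) $\alpha=1$, $\bar\alpha=-4$ and $F=c(\partial^4\lambda^2-10\partial^2\lambda^4-17\partial\lambda^5-8\lambda^6)$, $c\neq0$; (vi) $\alpha=\frac72\pm\frac{\sqrt{19}}2$,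 $\bar\alpha=-\frac52\pm\frac{\sqrt{19}}2$ (same sign) and $F=c\big(\partial^4\lambda^3-(2\bar\alpha+3)\partial^3\lambda^4-3\bar\alpha\partial^2\lambda^5-(3\bar\alpha+1)\partial\lambda^6-(\bar\alpha+\frac{9}{28})\lambda^7\big)$, $c\neq0$.
   Context: A conformal module over a Lie conformal algebra $\mathcal{R}$ is a $\mathbb{C}[\partial]$-module $V$ with $\mathbb{C}$-linear maps $\mathcal{R}\otimes V\to V[\lambda]$, $a\otimes v\mapsto a_\lambda v$, such that $(\partial a)_\lambda v=-\lambda a_\lambda v$, $a_\lambda(\partial v)=(\partial+\lambda)a_\lambda v$, and $a_\lambda(b_\mu v)-b_\mu(a_\lambda v)=[a_\lambda b]_{\lambda+\mu}v$. The Lie conformal algebra $\mathcal{W}(a,b)$ is the free $\mathbb{C}[\partial]$-module on $L,W$ with $[L_\lambda L]=(\partial+2\lambda)L$, $[L_\lambda W]=(\partial+a\lambda+b)W$, $[W_\lambda W]=0$. For $(a,b)\neq(1,0)$ and $\alpha\neq0$, $M_{\alpha,\beta}=\mathbb{C}[\partial]v$ with $L_\lambda v=(\partial+\alpha\lambda+\beta)v$, $W_\lambda v=0$. Every extension of $M_{\alpha,\beta}$ by $M_{\bar\alpha,\bar\beta}$ can be written in the displayed form with $f,g\in\mathbb{C}[\partial,\lambda]$, where $\mathbb{C}[\partial]v_{\bar\alpha}\cong M_{\bar\alpha,\bar\beta}$ is a submodule. Equivalence of extensions means a module homomorphism between middle terms compatible with the identities on the end terms; trivial means equivalent to the direct sum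 extension. *)

theory Defs
  imports "HOL-Computational_Algebra.Polynomial" "HOL-Analysis.Analysis"
begin

(* Elements of the Lie conformal algebra W(a,b): pairs (h,k) standing for h(\<partial>)L + k(\<partial>)W.
   Elements of the middle term E = C[\<partial>]vb \<oplus> C[\<partial>]v: pairs (p,q) standing for
   p(\<partial>) vb + q(\<partial>) v  (vb spans the submodule M_{alpha',beta}).
   Elements of X[\<lambda>] are handled pointwise in \<lambda> (all maps involved are C-linear,
   so this is equivalent to coefficientwise treatment). *)

type_synonym relt = "complex poly \<times> complex poly"
type_synonym eelt = "complex poly \<times> complex poly"

definition shiftp :: "complex poly \<Rightarrow> complex \<Rightarrow> complex poly" where
  "shiftp p l = pcompose p [:l, 1:]"

(* bivariate polynomials f(\<partial>,\<lambda>): outer variable \<lambda>, coefficients polynomials in \<partial> *)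
definition ev2 :: "complex poly poly \<Rightarrow> complex \<Rightarrow> complex \<Rightarrow> complex" where
  "ev2 f d l = poly (poly f [:l:]) d"

definition at_lam :: "complex poly poly \<Rightarrow> complex \<Rightarrow> complex poly" where
  "at_lam f l = poly f [:l:]"

definition eadd :: "eelt \<Rightarrow> eelt \<Rightarrow> eelt" where
  "eadd x y = (fst x + fst y, snd x + snd y)"

definition esub :: "eelt \<Rightarrow> eelt \<Rightarrow> eelt" where
  "esub x y = (fst x - fst y, snd x - snd y)"

definition emul :: "complex poly \<Rightarrow> eelt \<Rightarrow> eelt" where
  "emul r x = (r * fst x, r * snd x)"

(* \<lambda>-bracket of W(a,b), extended sesquilinearly:
   [(h1 X)_\<lambda> (h2 Y)] = h1(-\<lambda>) h2(\<partial>+\<lambda>) [X_\<lambda> Y], with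
   [L_\<lambda> L] = (\<partial>+2\<lambda>)L, [L_\<lambda> W] = (\<partial>+a\<lambda>+b)W, [W_\<lambda> W] = 0 and, by skew-symmetry,
   [W_\<lambda> L] = -[L_{-\<lambda>-\<partial>} W] = ((a-1)\<partial> + a\<lambda> - b)W. *)
definition Wbr :: "complex \<Rightarrow> complex \<Rightarrow> relt \<Rightarrow> complex \<Rightarrow> relt \<Rightarrow> relt" where
  "Wbr a b x l y =
     (smult (poly (fst x) (-l)) (shiftp (fst y) l * [:2*l, 1:]),
      smult (poly (fst x) (-l)) (shiftp (snd y) l * [:a*l + b, 1:])
      + smult (poly (snd x) (-l)) (shiftp (fst y) l * [:a*l - b, a - 1:]))"

(* The \<lambda>-action on E determined by
   L_\<lambda> vb = (\<partial>+alpha'\<lambda>+\<beta>) vb, W_\<lambda> vb = 0,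
   L_\<lambda> v = (\<partial>+\<alpha>\<lambda>+\<beta>) v + f(\<partial>,\<lambda>) vb, W_\<lambda> v = g(\<partial>,\<lambda>) vb,
   extended by (\<partial>a)_\<lambda> = -\<lambda> a_\<lambda> and a_\<lambda>(\<partial>x) = (\<partial>+\<lambda>) a_\<lambda> x. *)
definition act :: "complex \<Rightarrow> complex \<Rightarrow> complex \<Rightarrow> complex poly poly \<Rightarrow> complex poly poly
                    \<Rightarrow> relt \<Rightarrow> complex \<Rightarrow> eelt \<Rightarrow> eelt" where
  "act \<alpha> \<alpha>' \<beta> f g x l e =
    (let Lvb = ([:\<alpha>'*l + \<beta>, 1:], 0);
         Lv  = (at_lam f l, [:\<alpha>*l + \<beta>, 1:]);
         Wvb = (0, 0);
         Wv  = (at_lam g l, 0)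
     in eadd
         (emul [:poly (fst x) (-l):] (eadd (emul (shiftp (fst e) l) Lvb) (emul (shiftp (snd e) l) Lv)))
         (emul [:poly (snd x) (-l):] (eadd (emul (shiftp (fst e) l) Wvb) (emul (shiftp (snd e) l) Wv))))"

definition is_ext :: "complex \<Rightarrow> complex \<Rightarrow> complex \<Rightarrow> complex \<Rightarrow> complex
                      \<Rightarrow> complex poly poly \<Rightarrow> complex poly poly \<Rightarrow> bool" where
  "is_ext a b \<alpha> \<alpha>' \<beta> f g \<longleftrightarrow>
     (\<forall>x y e l m. esub (act \<alpha> \<alpha>' \<beta> f g x l (act \<alpha> \<alpha>' \<beta> f g y m e))
                         (act \<alpha> \<alpha>' \<beta> f g y m (act \<alpha> \<alpha>' \<beta> f g x l e))
                   = act \<alpha> \<alpha>' \<beta> f g (Wbr a b x l y) (l + m) e)"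

definition ext_equiv :: "complex \<Rightarrow> complex \<Rightarrow> complex \<Rightarrow> complex poly poly \<Rightarrow> complex poly poly
                         \<Rightarrow> complex poly poly \<Rightarrow> complex poly poly \<Rightarrow> bool" where
  "ext_equiv \<alpha> \<alpha>' \<beta> f g f' g' \<longleftrightarrow>
     (\<exists>\<phi> :: eelt \<Rightarrow> eelt.
        (\<forall>x y. \<phi> (eadd x y) = eadd (\<phi> x) (\<phi> y)) \<and>
        (\<forall>r x. \<phi> (emul r x) = emul r (\<phi> x)) \<and>
        (\<forall>p. \<phi> (p, 0) = (p, 0)) \<and>
        (\<forall>x. snd (\<phi> x) = snd x) \<and>
        (\<forall>x l e. \<phi> (act \<alpha> \<alpha>' \<beta> f g x l e) = act \<alpha> \<alpha>' \<beta> f' g' x l (\<phi> e)))"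

definition ext_trivial :: "complex \<Rightarrow> complex \<Rightarrow> complex \<Rightarrow> complex poly poly \<Rightarrow> complex poly poly \<Rightarrow> bool" where
  "ext_trivial \<alpha> \<alpha>' \<beta> f g \<longleftrightarrow> ext_equiv \<alpha> \<alpha>' \<beta> f g 0 0"

definition normal_form :: "complex \<Rightarrow> complex \<Rightarrow> complex \<Rightarrow> complex poly poly \<Rightarrow> bool" where
  "normal_form \<alpha> \<alpha>' \<beta> f \<longleftrightarrow>
    (\<alpha> = \<alpha>' \<and> (\<exists>a0 a1. (a0, a1) \<noteq> (0, 0) \<and>
        (\<forall>d l. ev2 f d l = (\<lambda>D. a0 + a1 * l) (d + \<beta>))))
  \<or> (\<alpha> - \<alpha>' = 2 \<and> (\<exists>c. c \<noteq> 0 \<and>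
        (\<forall>d l. ev2 f d l = (\<lambda>D. c * l^2 * (2*D + l)) (d + \<beta>))))
  \<or> (\<alpha> - \<alpha>' = 3 \<and> (\<exists>c. c \<noteq> 0 \<and>
        (\<forall>d l. ev2 f d l = (\<lambda>D. c * D * l^2 * (D + l)) (d + \<beta>))))
  \<or> (\<alpha> - \<alpha>' = 4 \<and> (\<exists>c. c \<noteq> 0 \<and>
        (\<forall>d l. ev2 f d l = (\<lambda>D. c * l^2 * (4*D^3 + 6*D^2*l - D*l^2 + \<alpha>'*l^3)) (d + \<beta>))))
  \<or> (\<alpha> = 1 \<and> \<alpha>' = -4 \<and> (\<exists>c. c \<noteq> 0 \<and>
        (\<forall>d l. ev2 f d l = (\<lambda>D. c * (D^4*l^2 - 10*D^2*l^4 - 17*D*l^5 - 8*l^6)) (d + \<beta>))))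
  \<or> ((\<exists>s::complex. (s = 1 \<or> s = -1) \<and>
          \<alpha> = 7/2 + s * complex_of_real (sqrt 19) / 2 \<and>
          \<alpha>' = -5/2 + s * complex_of_real (sqrt 19) / 2) \<and>
     (\<exists>c. c \<noteq> 0 \<and>
        (\<forall>d l. ev2 f d l = (\<lambda>D. c * (D^4*l^3 - (2*\<alpha>' + 3)*D^3*l^4 - 3*\<alpha>'*D^2*l^5
                                       - (3*\<alpha>' + 1)*D*l^6 - (\<alpha>' + 9/28)*l^7)) (d + \<beta>))))"

end

theory Submission
  imports Defs
begin

text \<open>
  Putting \<open>\<lambda> = 0\<close> in the relation between \<open>L\<close> and \<open>W\<close> gives \<open>b g = 0\<close>. What remains is a cocycle
  condition on \<open>F(D, \<lambda>) = f(D - \<beta>, \<lambda>)\<close>, modulo the coboundaries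
  \<open>(D + \<alpha>' \<lambda>) Q(D + \<lambda>) - (D + \<alpha> \<lambda>) Q(D)\<close>.

  The terms of order 0 in \<open>\<mu>\<close> force \<open>F(D, 0)\<close> to be constant, and to vanish unless \<open>\<alpha> = \<alpha>'\<close>. The terms
  of order 1 show that the Euler operator acts as the scalar \<open>\<alpha> - \<alpha>' + 1\<close> modulo coboundaries, so that
  \<open>F\<close> may be taken homogeneous of degree \<open>n + 1\<close> with \<open>n = \<alpha> - \<alpha>'\<close>. For \<open>n > 0\<close> one has
  \<open>F = \<Sum>\<^sub>i a\<^sub>i \<lambda>\<^sup>i D\<^bsup>n+1-i\<^esup>\<close> with \<open>i \<ge> 2\<close>, and the relations of order 2 in \<open>\<mu>\<close> determine all \<open>a\<^sub>i\<close> from \<open>a\<^sub>2\<close> and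
  \<open>a\<^sub>3\<close>. The coboundary of \<open>D\<^sup>n\<close> spans one dimension of this plane of candidates. With \<open>s = n + 2 \<alpha>'\<close>,
  the two expressions for \<open>a\<^sub>6\<close> agree outside this line only if \<open>n \<le> 4\<close> or \<open>s\<^sup>2 - 2 s = 3 n\<close>, and the
  expressions for \<open>a\<^sub>8\<close> then exclude \<open>n \<ge> 7\<close>. The equation \<open>s\<^sup>2 - 2 s = 3 n\<close> gives \<open>\<alpha>' \<in> {0, -4}\<close> for
  \<open>n = 5\<close> and \<open>2 \<alpha>'\<^sup>2 + 10 \<alpha>' + 3 = 0\<close> for \<open>n = 6\<close>.
\<close>

section \<open>Cocycles and coboundaries\<close>

text \<open>\<open>transl p\<close> is \<open>p(\<partial> + \<lambda>)\<close>, so its \<open>\<lambda>\<close>-coefficients are the Hasse derivatives of \<open>p\<close>.\<close>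

definition transl :: "'a::comm_ring_1 poly \<Rightarrow> 'a poly poly" where
  "transl p = pcompose (map_poly (\<lambda>c. [:c:]) p) [:[:0, 1:], 1:]"

text \<open>Fixing the inner variable leaves a univariate polynomial in \<lambda>, whose
  coefficients can then be compared.\<close>

definition slice :: "'a::comm_ring_1 poly poly \<Rightarrow> 'a \<Rightarrow> 'a poly" where
  "slice F D = map_poly (\<lambda>p. poly p D) F"

definition shift2 :: "'a::comm_ring_1 \<Rightarrow> 'a poly poly \<Rightarrow> 'a poly poly" where
  "shift2 c F = map_poly (\<lambda>p. pcompose p [:c, 1:]) F"

abbreviation cf :: "'a::zero poly poly \<Rightarrow> nat \<Rightarrow> nat \<Rightarrow> 'a" where
  "cf F i m \<equiv> coeff (coeff F i) m"

lemma coeff_slice: "coeff (slice F D) i = poly (coeff F i) D"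
  by (simp add: slice_def coeff_map_poly)

lemma poly_slice: "poly (slice F D) l = ev2 F D l"
  unfolding slice_def ev2_def
  by (induction F) (simp_all add: map_poly_pCons)

lemma poly_at_lam: "poly (at_lam F l) D = ev2 F D l"
  by (simp add: at_lam_def ev2_def)

lemma ev2_add [simp]: "ev2 (F + G) D l = ev2 F D l + ev2 G D l"
  and ev2_diff [simp]: "ev2 (F - G) D l = ev2 F D l - ev2 G D l"
  and ev2_0 [simp]: "ev2 0 D l = 0"
  and ev2_mult [simp]: "ev2 (F * G) D l = ev2 F D l * ev2 G D l"
  and ev2_smult [simp]: "ev2 (smult q F) D l = poly q D * ev2 F D l"
  by (simp_all add: ev2_def)

lemma ev2_inject: "F = G" if "\<And>D l. ev2 F D l = ev2 G D l"
proof (rule poly_eqI)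
  fix i
  have "slice F D = slice G D" for D
    using that by (intro poly_eq_poly_eq_iff[THEN iffD1] ext) (simp add: poly_slice)
  then have "poly (coeff F i) D = poly (coeff G i) D" for D
    by (metis coeff_slice)
  then show "coeff F i = coeff G i"
    using poly_eq_poly_eq_iff by blast
qed

lemma ev2_shift2 [simp]: "ev2 (shift2 c F) D l = ev2 F (D + c) l"
  unfolding shift2_def ev2_def
  by (induction F) (simp_all add: map_poly_pCons poly_pcompose add.commute)

lemma ev2_transl [simp]: "ev2 (transl p) D l = poly p (D + l)"
proof -
  have "poly (transl p) [:l:] = pcompose p [:l, 1:]"
    by (simp add: transl_def poly_pcompose pcompose_altdef[of p])
  then show ?thesis
    by (simp add: ev2_def poly_pcompose add.commute)
qed

lemma cf_transl: "cf (transl p) j m = of_nat (m + j choose j) * coeff p (m + j)"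
proof (induction p arbitrary: j m)
  case 0
  then show ?case by (simp add: transl_def)
next
  case (pCons c p)
  have *: "transl (pCons c p) = [:[:c:]:] + [:[:0, 1:], 1:] * transl p"
    by (simp add: transl_def map_poly_pCons pcompose_pCons)
  show ?case
    unfolding * using pCons.IH
    by (cases j; cases m) (simp_all add: algebra_simps)
qed

text \<open>Taylor's formula at \<open>x\<close>.\<close>

lemma coeff_pcompose_shift: "coeff (pcompose p [:x, 1:]) j = poly (coeff (transl p) j) x"
  for p :: "complex poly"
proof -
  have "pcompose p [:x, 1:] = slice (transl p) x"
    by (intro poly_eq_poly_eq_iff[THEN iffD1] ext) (simp add: poly_slice poly_pcompose)
  then show ?thesis
    by (simp add: coeff_slice)
qed

lemma poly_eq_coeffI: "coeff p n = coeff q n" if "\<And>x. poly p x = poly q x"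
  for p q :: "complex poly"
proof -
  have "poly p = poly q"
    using that by (rule ext)
  then show ?thesis
    by (simp add: poly_eq_poly_eq_iff)
qed

text \<open>Hasse derivatives in D act coefficientwise in \<lambda>, because \<open>transl\<close>
  is linear. This form exposes the \<lambda>-coefficients.\<close>

lemma poly_coeff_transl_at_lam:
  "poly (coeff (transl (at_lam F l)) j) D
     = poly (map_poly (\<lambda>p. poly (coeff (transl p) j) D) F) l"
  unfolding at_lam_def
proof (induction F)
  case 0
  then show ?case by (simp add: transl_def)
next
  case (pCons p F)
  have zero: "transl 0 = 0"
    by (simp add: transl_def)
  have add: "transl (p + q) = transl p + transl q" for p q :: "complex poly"
    by (rule ev2_inject) simp
  have smult: "transl (smult c q) = smult [:c:] (transl q)" for c and q :: "complex poly"
    by (rule ev2_inject) simp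
  show ?case
    using pCons.IH by (simp add: map_poly_pCons add smult zero)
qed

text \<open>The \<open>vb\<close>-component of the relation between \<open>L\<close> and
  \<open>L\<close> on \<open>v\<close>. Here D stands for \<partial> + \<beta>, which removes
  \<beta>.\<close>

definition cocycle :: "complex \<Rightarrow> complex \<Rightarrow> complex poly poly \<Rightarrow> bool" where
  "cocycle \<alpha> \<alpha>' F \<longleftrightarrow> (\<forall>D l m.
     (D + l + \<alpha> * m) * ev2 F D l + (D + \<alpha>' * l) * ev2 F (D + l) m
     - (D + m + \<alpha> * l) * ev2 F D m - (D + \<alpha>' * m) * ev2 F (D + m) l
     = (l - m) * ev2 F D (l + m))"

text \<open>The cocycle of the direct sum after its generator \<open>v\<close> is replaced by
  \<open>v + Q vb\<close>.\<close>

definition cobd :: "complex \<Rightarrow> complex \<Rightarrow> complex poly \<Rightarrow> complex poly poly" where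
  "cobd \<alpha> \<alpha>' Q = [:[:0, 1:], [:\<alpha>':]:] * transl Q - [:[:0, 1:], [:\<alpha>:]:] * [:Q:]"

lemma ev2_cobd [simp]:
  "ev2 (cobd \<alpha> \<alpha>' Q) D l = (D + \<alpha>' * l) * poly Q (D + l) - (D + \<alpha> * l) * poly Q D"
  unfolding cobd_def ev2_diff ev2_mult ev2_transl by (simp add: ev2_def mult.commute add.commute)

text \<open>\<open>wt \<alpha>' k i\<close> is the coefficient of \<open>\<lambda>\<^sup>i D\<^bsup>k+1-i\<^esup>\<close> in \<open>(D + \<alpha>' \<lambda>) (D + \<lambda>)\<^sup>k\<close>, for \<open>i \<ge> 1\<close>.\<close>

definition wt :: "complex \<Rightarrow> nat \<Rightarrow> nat \<Rightarrow> complex" where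
  "wt \<alpha>' k i = of_nat (k choose i) + \<alpha>' * of_nat (k choose (i - 1))"

lemma coeff_lin_mult: "coeff ([:a, b:] * p) (Suc n) = a * coeff p (Suc n) + b * coeff p n"
  by simp

text \<open>The product (D + \<alpha> \<lambda>) Q(D) has degree at most 1 in \<lambda>, so \<alpha>
  enters only at \<open>i = 0\<close>.\<close>

lemma cf_cobd:
  "cf (cobd \<alpha> \<alpha>' Q) (Suc i) m
     = (wt \<alpha>' (m + i) (Suc i) - (if i = 0 then \<alpha> else 0)) * coeff Q (m + i)"
  unfolding cobd_def coeff_diff coeff_lin_mult
  by (cases m; cases i)
    (simp_all add: cf_transl wt_def binomial_eq_0 algebra_simps del: binomial_Suc_Suc)

lemma cf_cobd_0: "coeff (cobd \<alpha> \<alpha>' Q) 0 = 0"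
proof -
  have "coeff (transl Q) 0 = Q"
    by (rule poly_eqI) (simp add: cf_transl)
  then show ?thesis by (simp add: cobd_def)
qed

lemma cocycle_diff: "cocycle \<alpha> \<alpha>' F \<Longrightarrow> cocycle \<alpha> \<alpha>' G \<Longrightarrow> cocycle \<alpha> \<alpha>' (F - G)"
  unfolding cocycle_def ev2_diff
proof (intro allI, goal_cases)
  case (1 D l m)
  show ?case
    using 1(1)[rule_format, of D l m] 1(2)[rule_format, of D l m] by algebra
qed

lemma cocycle_cobd: "cocycle \<alpha> \<alpha>' (cobd \<alpha> \<alpha>' Q)"
  unfolding cocycle_def ev2_cobd by (auto simp: algebra_simps)

text \<open>All later relations are instances: \<open>j = 0\<close> gives the Euler relation,
  \<open>j = 1\<close> a recursion in \<open>i\<close>. The hypothesis \<open>i > 0\<close> discards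
  (D + \<mu> + \<alpha> \<lambda>) F(D, \<mu>), whose degree in \<lambda> is at most 1.\<close>

lemma cocycle_coeff:
  assumes "cocycle \<alpha> \<alpha>' F" and "i > 0"
  shows "(if j = 0 then \<alpha> * cf F (Suc i) m else 0)
       + wt \<alpha>' (m + i) (Suc i) * cf F (Suc j) (m + i)
       - wt \<alpha>' (m + j) (Suc j) * cf F (Suc i) (m + j)
       = (of_nat (Suc (i + j) choose Suc j) - of_nat (Suc (i + j) choose j)) * cf F (Suc (i + j)) m"
proof -
  let ?T = "\<lambda>p j. coeff (transl p) j"
  txt \<open>First compare the coefficients of \<open>\<mu>\<^bsup>j+1\<^esup>\<close>, then those of \<open>\<lambda>\<^bsup>i+1\<^esup>\<close>, finally those of \<open>D\<^sup>m\<close>.\<close>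
  have mu: "(if j = 0 then \<alpha> * ev2 F D l else 0)
      + (D + \<alpha>' * l) * poly (coeff F (Suc j)) (D + l)
      - ((D + \<alpha> * l) * poly (coeff F (Suc j)) D + poly (coeff F j) D)
      - (D * poly (?T (at_lam F l) (Suc j)) D + \<alpha>' * poly (?T (at_lam F l) j) D)
      = l * poly (?T (slice F D) (Suc j)) l - poly (?T (slice F D) j) l" (is "?lhs = ?rhs") for D l
  proof -
    let ?p = "[:(D + l) * ev2 F D l, \<alpha> * ev2 F D l:] + smult (D + \<alpha>' * l) (slice F (D + l))
        - [:D + \<alpha> * l, 1:] * slice F D - [:D, \<alpha>':] * pcompose (at_lam F l) [:D, 1:]"
    let ?q = "[:l, -1:] * pcompose (slice F D) [:l, 1:]"
    have "poly ?p x = poly ?q x" for x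
      using assms(1)[unfolded cocycle_def, rule_format, of D l x]
      by (simp add: poly_slice poly_pcompose poly_at_lam algebra_simps)
    then have "coeff ?p (Suc j) = coeff ?q (Suc j)"
      by (rule poly_eq_coeffI)
    then show ?thesis
      unfolding coeff_diff coeff_add coeff_lin_mult coeff_smult coeff_pcompose_shift coeff_slice
      by (cases j) simp_all
  qed
  have "poly ((if j = 0 then smult \<alpha> (coeff F (Suc i)) else 0)
      + [:0, 1:] * ?T (coeff F (Suc j)) (Suc i) + smult \<alpha>' (?T (coeff F (Suc j)) i)
      - ([:0, 1:] * ?T (coeff F (Suc i)) (Suc j) + smult \<alpha>' (?T (coeff F (Suc i)) j))) D
     = poly (smult (of_nat (Suc (i + j) choose Suc j) - of_nat (Suc (i + j) choose j))
         (coeff F (Suc (i + j)))) D" for D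
  proof -
    \<comment> \<open>\<open>?M j\<close> carries the Hasse derivatives in D of the
      \<lambda>-coefficients; \<open>?p\<close> and \<open>?q\<close> are the sides of
      \<open>mu\<close> as polynomials in \<lambda>, up to moving one term across.\<close>
    let ?M = "\<lambda>j. map_poly (\<lambda>p. poly (?T p j) D) F"
    let ?p = "(if j = 0 then smult \<alpha> (slice F D) else 0)
        + [:D, \<alpha>':] * pcompose (coeff F (Suc j)) [:D, 1:]
        - [:D * poly (coeff F (Suc j)) D + poly (coeff F j) D, \<alpha> * poly (coeff F (Suc j)) D:]
        - (smult D (?M (Suc j)) + smult \<alpha>' (?M j))"
    let ?q = "[:0, 1:] * ?T (slice F D) (Suc j) - ?T (slice F D) j"
    have "poly ?p x = poly ?q x" for x
      using mu[of D x]
      by (cases "j = 0") (simp_all add: poly_slice poly_pcompose poly_coeff_transl_at_lam algebra_simps)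
    then have "coeff ?p (Suc i) = coeff ?q (Suc i)"
      by (rule poly_eq_coeffI)
    moreover have "coeff ?q (Suc i) = (of_nat (Suc (i + j) choose Suc j) - of_nat (Suc (i + j) choose j))
        * poly (coeff F (Suc (i + j))) D"
      unfolding coeff_diff coeff_lin_mult cf_transl coeff_slice
      by (simp add: algebra_simps del: binomial_Suc_Suc)
    moreover have "coeff (?M k) (Suc i) = poly (?T (coeff F (Suc i)) k) D" for k
      by (simp add: coeff_map_poly transl_def)
    moreover obtain i' where "i = Suc i'"
      using assms(2) by (cases i) auto
    ultimately show ?thesis
      unfolding coeff_diff coeff_add coeff_lin_mult coeff_smult coeff_pcompose_shift
      by (cases "j = 0") (simp_all add: coeff_slice add.assoc del: binomial_Suc_Suc)
  qed
  then have "coeff ((if j = 0 then smult \<alpha> (coeff F (Suc i)) else 0)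
      + [:0, 1:] * ?T (coeff F (Suc j)) (Suc i) + smult \<alpha>' (?T (coeff F (Suc j)) i)
      - ([:0, 1:] * ?T (coeff F (Suc i)) (Suc j) + smult \<alpha>' (?T (coeff F (Suc i)) j))) m
     = coeff (smult (of_nat (Suc (i + j) choose Suc j) - of_nat (Suc (i + j) choose j))
         (coeff F (Suc (i + j)))) m"
    by (rule poly_eq_coeffI)
  then show ?thesis
    using assms(2)
    by (cases m; cases "j = 0")
      (simp_all add: cf_transl wt_def binomial_eq_0 algebra_simps del: binomial_Suc_Suc)
qed

section \<open>Extensions as cocycles\<close>

lemma act_eq:
  "act \<alpha> \<alpha>' \<beta> f g x l e =
    (smult (poly (fst x) (-l))
       (shiftp (fst e) l * [:\<alpha>' * l + \<beta>, 1:] + shiftp (snd e) l * at_lam f l)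
     + smult (poly (snd x) (-l)) (shiftp (snd e) l * at_lam g l),
     smult (poly (fst x) (-l)) (shiftp (snd e) l * [:\<alpha> * l + \<beta>, 1:]))"
  by (simp add: act_def eadd_def emul_def Let_def)

lemma poly_shiftp [simp]: "poly (shiftp p l) d = poly p (d + l)"
  by (simp add: shiftp_def poly_pcompose add.commute)

lemma eelt_eqI:
  "x = y" if "\<And>d. poly (fst x) d = poly (fst y) d" "\<And>d. poly (snd x) d = poly (snd y) d"
  for x y :: eelt
  using that by (intro prod_eqI poly_eq_poly_eq_iff[THEN iffD1] ext)

lemma is_ext_imp_g_eq_0:
  assumes "is_ext a b \<alpha> \<alpha>' \<beta> f g" and "b \<noteq> 0"
  shows "g = 0"
proof (rule ev2_inject)
  fix d m
  \<comment> \<open>On \<open>v\<close>, the left side has \<open>vb\<close>-component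
    \<open>- m * g\<close> and the right side \<open>(b - m) * g\<close>.\<close>
  have "poly (fst (esub (act \<alpha> \<alpha>' \<beta> f g (1, 0) 0 (act \<alpha> \<alpha>' \<beta> f g (0, 1) m (0, 1)))
          (act \<alpha> \<alpha>' \<beta> f g (0, 1) m (act \<alpha> \<alpha>' \<beta> f g (1, 0) 0 (0, 1))))) d
      = poly (fst (act \<alpha> \<alpha>' \<beta> f g (Wbr a b (1, 0) 0 (0, 1)) (0 + m) (0, 1))) d"
    using assms(1) unfolding is_ext_def by metis
  then have "b * ev2 g d m = 0"
    by (simp add: act_eq esub_def Wbr_def poly_at_lam algebra_simps)
  then show "ev2 g d m = ev2 0 d m"
    using assms(2) by simp
qed

text \<open>By sesquilinearity the generators suffice, and \<open>W\<close> acts as zero. On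
  \<open>vb\<close> and modulo \<open>vb\<close> the identity holds because both ends are modules,
  so only \<open>L\<close> and \<open>L\<close> on \<open>v\<close> give a condition.\<close>

lemma is_ext_iff_cocycle: "is_ext a b \<alpha> \<alpha>' \<beta> f 0 \<longleftrightarrow> cocycle \<alpha> \<alpha>' (shift2 (-\<beta>) f)"
proof
  assume *: "is_ext a b \<alpha> \<alpha>' \<beta> f 0"
  show "cocycle \<alpha> \<alpha>' (shift2 (-\<beta>) f)"
    unfolding cocycle_def ev2_shift2
  proof (intro allI)
    fix D l m
    have "poly (fst (esub (act \<alpha> \<alpha>' \<beta> f 0 (1, 0) l (act \<alpha> \<alpha>' \<beta> f 0 (1, 0) m (0, 1)))
            (act \<alpha> \<alpha>' \<beta> f 0 (1, 0) m (act \<alpha> \<alpha>' \<beta> f 0 (1, 0) l (0, 1))))) (D - \<beta>)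
        = poly (fst (act \<alpha> \<alpha>' \<beta> f 0 (Wbr a b (1, 0) l (1, 0)) (l + m) (0, 1))) (D - \<beta>)"
      using * unfolding is_ext_def by metis
    then show "(D + l + \<alpha> * m) * ev2 f (D + - \<beta>) l + (D + \<alpha>' * l) * ev2 f (D + l + - \<beta>) m
        - (D + m + \<alpha> * l) * ev2 f (D + - \<beta>) m - (D + \<alpha>' * m) * ev2 f (D + m + - \<beta>) l
        = (l - m) * ev2 f (D + - \<beta>) (l + m)"
      by (simp add: act_eq esub_def Wbr_def poly_at_lam algebra_simps)
  qed
next
  assume *: "cocycle \<alpha> \<alpha>' (shift2 (-\<beta>) f)"
  show "is_ext a b \<alpha> \<alpha>' \<beta> f 0"
    unfolding is_ext_def
  proof (intro allI, rule eelt_eqI, goal_cases)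
    case (1 x y e l m d)
    let ?c = "poly (fst x) (-l) * poly (fst y) (-m)"
    let ?A = "(d + \<beta> + l + \<alpha> * m) * ev2 f d l + (d + \<beta> + \<alpha>' * l) * ev2 f (d + l) m
        - (d + \<beta> + m + \<alpha> * l) * ev2 f d m - (d + \<beta> + \<alpha>' * m) * ev2 f (d + m) l"
    have A: "?A = (l - m) * ev2 f d (l + m)"
      using *[unfolded cocycle_def, rule_format, of "d + \<beta>" l m] by (simp add: algebra_simps)
    have "poly (fst (esub (act \<alpha> \<alpha>' \<beta> f 0 x l (act \<alpha> \<alpha>' \<beta> f 0 y m e))
                         (act \<alpha> \<alpha>' \<beta> f 0 y m (act \<alpha> \<alpha>' \<beta> f 0 x l e)))) d
        = ?c * ((l - m) * (d + \<beta> + \<alpha>' * (l + m)) * poly (fst e) (d + l + m)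
                + ?A * poly (snd e) (d + l + m))"
      by (simp add: act_eq esub_def poly_at_lam algebra_simps)
    also have "\<dots> = poly (fst (act \<alpha> \<alpha>' \<beta> f 0 (Wbr a b x l y) (l + m) e)) d"
      unfolding A by (simp add: act_eq Wbr_def poly_at_lam algebra_simps)
    finally show ?case .
  next
    case (2 x y e l m d)
    show ?case
      by (simp add: act_eq Wbr_def esub_def algebra_simps)
  qed
qed

lemma ext_equivI:
  assumes "\<And>d l. ev2 f d l - ev2 f' d l
      = (d + \<beta> + \<alpha>' * l) * poly P (d + l) - (d + \<beta> + \<alpha> * l) * poly P d"
  shows "ext_equiv \<alpha> \<alpha>' \<beta> f 0 f' 0"
  unfolding ext_equiv_def
\<comment> \<open>The linear map that fixes \<open>vb\<close> and sends \<open>v\<close> to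
  \<open>v + P vb\<close>.\<close>
proof (intro exI[of _ "\<lambda>e. (fst e + snd e * P, snd e)"] conjI allI, goal_cases)
  case (5 x l e)
  show ?case
  proof (rule eelt_eqI, goal_cases)
    case (1 d)
    let ?c = "poly (fst x) (-l)"
    have "poly (fst (act \<alpha> \<alpha>' \<beta> f 0 x l e) + snd (act \<alpha> \<alpha>' \<beta> f 0 x l e) * P) d
        = ?c * (poly (fst e) (d + l) * (d + \<beta> + \<alpha>' * l)
            + poly (snd e) (d + l) * (ev2 f d l + (d + \<beta> + \<alpha> * l) * poly P d))"
      by (simp add: act_eq poly_at_lam algebra_simps)
    also have "ev2 f d l + (d + \<beta> + \<alpha> * l) * poly P d
        = ev2 f' d l + (d + \<beta> + \<alpha>' * l) * poly P (d + l)"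
      using assms[of d l] by (simp add: algebra_simps)
    finally show ?case
      by (simp add: act_eq poly_at_lam algebra_simps)
  qed (simp add: act_eq)
qed (auto simp: eadd_def emul_def algebra_simps)

text \<open>Linearity over polynomials in \<partial> makes an equivalence depend only on the
  \<open>vb\<close>-component \<open>P\<close> of the image of \<open>v\<close>; the action of
  \<open>L\<close> on \<open>v\<close> then yields the equation.\<close>

lemma ext_equivD:
  assumes "ext_equiv \<alpha> \<alpha>' \<beta> f 0 f' 0"
  obtains P where "\<And>d l. ev2 f d l - ev2 f' d l
      = (d + \<beta> + \<alpha>' * l) * poly P (d + l) - (d + \<beta> + \<alpha> * l) * poly P d"
proof -
  obtain \<phi> where add: "\<And>x y. \<phi> (eadd x y) = eadd (\<phi> x) (\<phi> y)"
    and mul: "\<And>r x. \<phi> (emul r x) = emul r (\<phi> x)"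
    and id: "\<And>p. \<phi> (p, 0) = (p, 0)"
    and snd: "\<And>x. snd (\<phi> x) = snd x"
    and act: "\<And>x l e. \<phi> (act \<alpha> \<alpha>' \<beta> f 0 x l e) = act \<alpha> \<alpha>' \<beta> f' 0 x l (\<phi> e)"
    using assms unfolding ext_equiv_def by blast
  define P where "P = fst (\<phi> (0, 1))"
  have \<phi>: "\<phi> (p, q) = (p + q * P, q)" for p q
  proof -
    have "(p, q) = eadd (p, 0) (emul q (0, 1))"
      by (simp add: eadd_def emul_def)
    then have "fst (\<phi> (p, q)) = p + q * P"
      by (simp only: add mul id) (simp add: eadd_def emul_def P_def)
    then show ?thesis
      using snd[of "(p, q)"] by (metis prod.collapse snd_conv)
  qed
  have "ev2 f d l - ev2 f' d l
      = (d + \<beta> + \<alpha>' * l) * poly P (d + l) - (d + \<beta> + \<alpha> * l) * poly P d" for d l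
  proof -
    have "poly (fst (\<phi> (act \<alpha> \<alpha>' \<beta> f 0 (1, 0) l (0, 1)))) d
        = poly (fst (act \<alpha> \<alpha>' \<beta> f' 0 (1, 0) l (\<phi> (0, 1)))) d"
      by (simp only: act)
    then show ?thesis
      by (simp add: act_eq \<phi> poly_at_lam algebra_simps)
  qed
  then show ?thesis
    using that by blast
qed

lemma ext_equiv_cobd:
  assumes "shift2 (-\<beta>) f = G + cobd \<alpha> \<alpha>' Q"
  shows "ext_equiv \<alpha> \<alpha>' \<beta> f 0 (shift2 \<beta> G) 0"
proof (rule ext_equivI)
  fix d l
  have "ev2 (shift2 (-\<beta>) f) (d + \<beta>) l = ev2 (G + cobd \<alpha> \<alpha>' Q) (d + \<beta>) l"
    using assms by simp
  then show "ev2 f d l - ev2 (shift2 \<beta> G) d l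
      = (d + \<beta> + \<alpha>' * l) * poly (pcompose Q [:\<beta>, 1:]) (d + l)
        - (d + \<beta> + \<alpha> * l) * poly (pcompose Q [:\<beta>, 1:]) d"
    by (simp add: poly_pcompose algebra_simps)
qed

lemma ext_trivial_imp_cobd:
  assumes "ext_trivial \<alpha> \<alpha>' \<beta> f 0"
  obtains Q where "shift2 (-\<beta>) f = cobd \<alpha> \<alpha>' Q"
proof -
  obtain P where P: "\<And>d l. ev2 f d l - ev2 0 d l
      = (d + \<beta> + \<alpha>' * l) * poly P (d + l) - (d + \<beta> + \<alpha> * l) * poly P d"
    using assms ext_equivD unfolding ext_trivial_def by metis
  have "shift2 (-\<beta>) f = cobd \<alpha> \<alpha>' (pcompose P [:-\<beta>, 1:])"
  proof (rule ev2_inject)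
    fix D l
    show "ev2 (shift2 (-\<beta>) f) D l = ev2 (cobd \<alpha> \<alpha>' (pcompose P [:-\<beta>, 1:])) D l"
      using P[of "D - \<beta>" l] by (simp add: poly_pcompose algebra_simps)
  qed
  then show ?thesis
    using that by blast
qed

section \<open>Reduction to homogeneous cocycles\<close>

text \<open>Putting \<mu> = 0 in the cocycle identity gives \<open>eq\<close>. At D = 0 it makes
  \<open>h\<close> constant, after division by \<open>\<alpha>'\<close>, and then compares \<alpha>
  with \<open>\<alpha>'\<close>.\<close>

lemma cocycle_coeff_0:
  assumes "cocycle \<alpha> \<alpha>' F" and "\<alpha>' \<noteq> 0"
  obtains c where "coeff F 0 = [:c:]" and "\<alpha> = \<alpha>' \<or> c = 0"
proof -
  define h where "h = coeff F 0"
  have h: "ev2 F D 0 = poly h D" for D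
    by (simp add: h_def poly_0_coeff_0 flip: poly_slice coeff_slice)
  have eq: "(D + \<alpha>' * l) * poly h (D + l) = (D + \<alpha> * l) * poly h D" for D l
    using assms(1)[unfolded cocycle_def, rule_format, of D l 0] by (simp add: h algebra_simps)
  have "poly ([:0, 1:] * h) x = poly [:0, \<alpha> / \<alpha>' * poly h 0:] x" for x
    using eq[of 0 x] assms(2) by (simp add: field_simps)
  then have "[:0, 1:] * h = [:0, \<alpha> / \<alpha>' * poly h 0:]"
    by (intro poly_eq_poly_eq_iff[THEN iffD1] ext)
  then have "h = [:\<alpha> / \<alpha>' * poly h 0:]"
    by simp
  then obtain c where c: "h = [:c:]" by blast
  moreover have "\<alpha> = \<alpha>' \<or> c = 0"
    using eq[of 0 1] c by auto
  ultimately show ?thesis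
    using that unfolding h_def by blast
qed

text \<open>The coboundary of D^k has coefficient \<open>k - K\<close> at \<lambda> D^k, so
  \<open>Q\<close> can clear every term linear in \<lambda> except the one with
  \<open>k = K\<close>. The relation with \<open>j = 0\<close> then multiplies each remaining
  coefficient by \<open>K + 1\<close> minus its total degree.\<close>

lemma euler_reduction:
  assumes "cocycle \<alpha> \<alpha>' F"
  obtains Q where "\<And>i m. i > 0 \<Longrightarrow> of_nat (m + i) \<noteq> \<alpha> - \<alpha>' + 1 \<Longrightarrow> cf (F - cobd \<alpha> \<alpha>' Q) i m = 0"
proof -
  define K where "K = \<alpha> - \<alpha>'"
  txt \<open>The resonant coefficient \<open>k = K\<close> is set to 0 by division by zero.\<close>
  define Q where "Q = (\<Sum>k\<le>degree (coeff F 1). monom (cf F 1 k / (of_nat k - K)) k)"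
  have Q: "coeff Q k = cf F 1 k / (of_nat k - K)" for k
    by (auto simp: Q_def coeff_sum sum.delta coeff_eq_0)
  have coc: "cocycle \<alpha> \<alpha>' (F - cobd \<alpha> \<alpha>' Q)"
    using assms cocycle_cobd cocycle_diff by blast
  have 1: "cf (F - cobd \<alpha> \<alpha>' Q) (Suc 0) m = 0" if "of_nat m \<noteq> K" for m
  proof -
    have "cf (cobd \<alpha> \<alpha>' Q) (Suc 0) m = (of_nat m - K) * coeff Q m"
      by (simp add: cf_cobd wt_def K_def algebra_simps)
    then show ?thesis
      using that by (simp add: Q)
  qed
  have "cf (F - cobd \<alpha> \<alpha>' Q) (Suc (Suc i)) m = 0" if "of_nat (m + Suc i) \<noteq> K" for i m
  proof -
    have "(K - of_nat (m + Suc i)) * cf (F - cobd \<alpha> \<alpha>' Q) (Suc (Suc i)) m = 0"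
      using cocycle_coeff[OF coc, of "Suc i" 0 m] 1[OF that]
      by (simp add: wt_def K_def algebra_simps)
    then show ?thesis
      using that by simp
  qed
  with 1 have "cf (F - cobd \<alpha> \<alpha>' Q) i m = 0" if "i > 0" "of_nat (m + i) \<noteq> \<alpha> - \<alpha>' + 1" for i m
    using that by (cases i; cases "i - 1") (auto simp: K_def algebra_simps)
  then show ?thesis
    using that by blast
qed

definition homog :: "nat \<Rightarrow> complex poly poly \<Rightarrow> bool" where
  "homog n F \<longleftrightarrow> (\<forall>i m. cf F i m \<noteq> 0 \<longrightarrow> i \<ge> 2 \<and> m + i = Suc n)"

lemma homog_diff: "homog n F \<Longrightarrow> homog n G \<Longrightarrow> homog n (F - G)"
  unfolding homog_def coeff_diff by (metis diff_0_right)

text \<open>At the resonant exponent the \<lambda>-linear term cancels, since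
  \<open>wt \<alpha>' n 1 = n + \<alpha>'\<close>. This coboundary is the freedom left by the Euler
  reduction.\<close>

lemma homog_cobd_monom: "homog n (cobd \<alpha> \<alpha>' (monom c n))" if "\<alpha> - \<alpha>' = of_nat n"
  unfolding homog_def
proof (intro allI impI)
  fix i m
  assume *: "cf (cobd \<alpha> \<alpha>' (monom c n)) i m \<noteq> 0"
  then obtain i' where i: "i = Suc i'"
    by (cases i) (auto simp: cf_cobd_0)
  have n: "n = m + i'"
    using * by (auto simp: i cf_cobd split: if_splits)
  have "i' \<noteq> 0"
  proof
    assume "i' = 0"
    then have "wt \<alpha>' (m + i') (Suc i') = \<alpha>"
      using n that by (simp add: wt_def algebra_simps)
    then show False
      using * \<open>i' = 0\<close> by (simp add: i cf_cobd)
  qed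
  with n show "i \<ge> 2 \<and> m + i = Suc n"
    by (simp add: i)
qed

lemma cocycle_reduction:
  assumes "cocycle \<alpha> \<alpha>' F" and "\<alpha>' \<noteq> 0"
  obtains (trivial) Q where "F = cobd \<alpha> \<alpha>' Q"
  | (zero) Q a0 a1 where "\<alpha> = \<alpha>'" "F = [:[:a0:], [:a1:]:] + cobd \<alpha> \<alpha>' Q"
  | (pos) Q G n where "\<alpha> - \<alpha>' = of_nat n" "n > 0" "F = G + cobd \<alpha> \<alpha>' Q" "homog n G" "cocycle \<alpha> \<alpha>' G"
proof -
  obtain Q where Q: "\<And>i m. i > 0 \<Longrightarrow> of_nat (m + i) \<noteq> \<alpha> - \<alpha>' + 1 \<Longrightarrow> cf (F - cobd \<alpha> \<alpha>' Q) i m = 0"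
    using euler_reduction[OF assms(1)] by blast
  define G where "G = F - cobd \<alpha> \<alpha>' Q"
  have F: "F = G + cobd \<alpha> \<alpha>' Q"
    by (simp add: G_def)
  have coc: "cocycle \<alpha> \<alpha>' G"
    unfolding G_def using assms(1) cocycle_cobd cocycle_diff by blast
  have G: "cf G i m = 0" if "i > 0" "of_nat (m + i) \<noteq> \<alpha> - \<alpha>' + 1" for i m
    using that Q unfolding G_def by blast
  obtain c where c: "coeff G 0 = [:c:]" "\<alpha> = \<alpha>' \<or> c = 0"
    using cocycle_coeff_0[OF coc assms(2)] by blast
  \<comment> \<open>A surviving term with \<open>i > 0\<close> has
    \<open>m + i = \<alpha> - \<alpha>' + 1\<close>, so it needs a natural number as the
    difference.\<close>
  consider "\<forall>n. \<alpha> - \<alpha>' \<noteq> of_nat n" | "\<alpha> = \<alpha>'" | n where "\<alpha> - \<alpha>' = of_nat n" "n > 0"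
    by (metis eq_iff_diff_eq_0 neq0_conv of_nat_0)
  then show ?thesis
  proof cases
    case 1
    have "c = 0"
      using c 1[rule_format, of 0] by auto
    have "cf G i m = 0" for i m
    proof (cases i)
      case (Suc i')
      then show ?thesis
        using 1[rule_format, of "m + i'"] by (intro G) (auto simp: algebra_simps)
    qed (simp add: c(1) \<open>c = 0\<close>)
    then have "G = 0"
      by (intro poly_eqI) simp
    then show ?thesis
      using trivial F by auto
  next
    case 2
    have "cf G i m = 0" if "i + m > 1" "i > 0" for i m
    proof (rule G[OF that(2)])
      have "m + i \<noteq> 1" using that by simp
      then show "of_nat (m + i) \<noteq> \<alpha> - \<alpha>' + 1"
        using 2 by (metis add_cancel_right_left diff_self of_nat_1 of_nat_eq_iff)
    qed
    then have "G = [:[:c:], [:cf G 1 0:]:]"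
      by (intro poly_eqI) (auto simp: c(1) coeff_pCons split: nat.split)
    then show ?thesis
      using zero 2 F by metis
  next
    case (3 n)
    have deg: "m + i = Suc n" if "cf G i m \<noteq> 0" "i > 0" for i m
    proof -
      have "of_nat (m + i) = \<alpha> - \<alpha>' + 1"
        using G[of i m] that by blast
      then have "of_nat (m + i) = (of_nat (Suc n) :: complex)"
        by (simp add: 3(1))
      then show ?thesis
        by (simp only: of_nat_eq_iff)
    qed
    have "c = 0"
      using c(2) 3 by auto
    have "cf G (Suc 0) n = 0"
    proof -
      \<comment> \<open>The Euler reduction leaves the resonant term \<lambda> D^n. In the relation
        for \<lambda>^(n+1) \<mu>, the terms in \<open>cf G (Suc n) 0\<close> cancel by
        \<open>\<alpha> - \<alpha>' = n\<close>.\<close>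
      have "\<alpha>' * cf G (Suc 0) n = 0"
        using cocycle_coeff[OF coc 3(2), of 0 0] 3(1)
        by (simp add: wt_def algebra_simps binomial_eq_0)
      then show ?thesis
        using assms(2) by simp
    qed
    have "homog n G"
      unfolding homog_def
    proof (intro allI impI)
      fix i m
      assume *: "cf G i m \<noteq> 0"
      have "i \<noteq> 0"
        using * \<open>c = 0\<close> c(1) by (intro notI) simp
      moreover have "i \<noteq> 1"
        using * deg[of i m] \<open>cf G (Suc 0) n = 0\<close> by (intro notI) auto
      ultimately show "i \<ge> 2 \<and> m + i = Suc n"
        using deg[OF *] by simp
    qed
    then show ?thesis
      using pos 3 F coc by blast
  qed
qed

section \<open>Determination of a cocycle by its lowest coefficients\<close>

text \<open>The relation with \<open>j = 1\<close> expresses coefficient \<open>i\<close> through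
  those at \<open>i - 1\<close> and 2, with factor \<open>i * (i - 3) / 2\<close>. The recursion
  therefore starts only after \<open>i = 3\<close>.\<close>

lemma cocycle_eq_0:
  assumes "cocycle \<alpha> \<alpha>' F" and "\<And>i. i \<le> 3 \<Longrightarrow> coeff F i = 0"
  shows "F = 0"
proof -
  have "coeff F i = 0" for i
  proof (induction i rule: less_induct)
    case (less i)
    show ?case
    proof (cases "i \<le> 3")
      case False
      define k where "k = i - 4"
      have i: "i = Suc (Suc (Suc (Suc k)))"
        using False by (simp add: k_def)
      have *: "coeff F (Suc (Suc (Suc k))) = 0" "coeff F (Suc (Suc 0)) = 0"
        using less assms(2)[of 2] by (auto simp: i numeral_2_eq_2)
      show ?thesis
      proof (rule poly_eqI)
        fix m
        have "(of_nat (Suc (Suc (Suc (Suc k))) choose Suc 1) - of_nat (Suc (Suc (Suc (Suc k))) choose 1))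
            * cf F i m = 0"
          using cocycle_coeff[OF assms(1), of "Suc (Suc k)" 1 m] * by (simp add: i del: binomial_Suc_Suc)
        moreover have "Suc (Suc (Suc (Suc k))) choose Suc 1 \<noteq> Suc (Suc (Suc (Suc k))) choose 1"
          by simp
        ultimately show "cf F i m = coeff 0 m"
          by (metis coeff_0 eq_iff_diff_eq_0 mult_eq_0_iff of_nat_eq_iff)
      qed
    qed (simp add: assms(2))
  qed
  then show ?thesis
    by (intro poly_eqI) simp
qed

text \<open>Homogeneity leaves only \<lambda>^2 D^(n-1) and \<lambda>^3 D^(n-2) to check in the
  difference. The second exists only for \<open>n \<ge> 2\<close>, where \<open>n - 2\<close> is
  exact.\<close>

lemma homog_cocycle_eqI:
  assumes "cocycle \<alpha> \<alpha>' G" "homog n G" "cocycle \<alpha> \<alpha>' N" "homog n N"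
    and "\<alpha> - \<alpha>' = of_nat n"
    and "cf G 2 (n - 1) = cf N 2 (n - 1) + q * wt \<alpha>' n 2"
    and "n \<ge> 2 \<Longrightarrow> cf G 3 (n - 2) = cf N 3 (n - 2) + q * wt \<alpha>' n 3"
    and "n > 0"
  shows "G = N + cobd \<alpha> \<alpha>' (monom q n)"
proof -
  let ?H = "G - N - cobd \<alpha> \<alpha>' (monom q n)"
  have hom: "homog n ?H"
    using assms by (intro homog_diff homog_cobd_monom)
  have "cf ?H 2 (n - 1) = 0"
    using assms(6,8) cf_cobd[of \<alpha> \<alpha>' "monom q n" 1 "n - 1"] by (simp add: numeral_2_eq_2)
  moreover have "cf ?H 3 (n - 2) = 0" if "n \<ge> 2"
  proof -
    have "n - 2 + 2 = n" using that by simp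
    then show ?thesis
      using assms(7) that cf_cobd[of \<alpha> \<alpha>' "monom q n" 2 "n - 2"] by (simp add: numeral_3_eq_3)
  qed
  ultimately have "cf ?H i m = 0" if "i \<le> 3" for i m
  proof -
    have "i = 2 \<and> m = n - 1 \<or> i = 3 \<and> m = n - 2 \<and> n \<ge> 2" if "cf ?H i m \<noteq> 0"
      using hom that \<open>i \<le> 3\<close> unfolding homog_def by fastforce
    then show ?thesis
      using \<open>cf ?H 2 (n - 1) = 0\<close> \<open>n \<ge> 2 \<Longrightarrow> cf ?H 3 (n - 2) = 0\<close> by blast
  qed
  then have "?H = 0"
    using assms(1,3) cocycle_cobd by (intro cocycle_eq_0 cocycle_diff poly_eqI) auto
  then show ?thesis
    by (simp add: algebra_simps)
qed

section \<open>Relations among coefficients of total degree n + 1\<close>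

text \<open>A reindexing of \<open>cocycle_coeff\<close> by the exponents of \<lambda> and \<mu>
  themselves; \<open>i + j \<le> n + 2\<close> keeps the subtractions exact.\<close>

lemma homog_coeff:
  assumes "cocycle \<alpha> \<alpha>' G" and "i \<ge> 2" "j \<ge> 2" "i + j \<le> n + 2"
  shows "wt \<alpha>' (n + 1 - j) i * cf G j (n + 1 - j) - wt \<alpha>' (n + 1 - i) j * cf G i (n + 1 - i)
      = (of_nat (i + j - 1 choose j) - of_nat (i + j - 1 choose (j - 1))) * cf G (i + j - 1) (n + 2 - (i + j))"
proof -
  define i' j' m where "i' = i - 2" and "j' = j - 2" and "m = n + 2 - (i + j)"
  have i: "i = Suc (Suc i')" and j: "j = Suc (Suc j')"
    using assms(2,3) by (simp_all add: i'_def j'_def)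
  have n: "n = m + i' + j' + 2"
    using assms(2-4) by (simp add: i'_def j'_def m_def)
  show ?thesis
    using cocycle_coeff[OF assms(1), of "Suc i'" "Suc j'" m]
    by (simp add: i j n algebra_simps del: binomial_Suc_Suc)
qed

text \<open>Here \<open>p, q, B4, B5, B6\<close> stand for \<open>a\<^sub>2, a\<^sub>3, 12 a\<^sub>4, 120 a\<^sub>5, 2160 a\<^sub>6\<close>, where \<open>a\<^sub>i\<close> is the coefficient of
  \<open>\<lambda>\<^sup>i D\<^bsup>n+1-i\<^esup>\<close> in a homogeneous cocycle, and the assumptions are the relations indexed by
  \<open>(3,2), (4,2), (5,2)\<close>. The right-hand sides vanish by the relation \<open>(4,3)\<close>, respectively by
  \<open>(6,3)\<close> and \<open>(5,4)\<close>.\<close>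

lemma elimination_degree_6:
  fixes x t p q :: complex
  assumes B4: "B4 = (x-1)*(x-2)*(x-3+3*t)*p - 3*((x-2)*(x-3+2*t))*q"
   and B5: "B5 = (x-1)*(x-2)*(x-3)*(x-4+4*t)*p - (x-3)*(x-4+2*t)*B4"
   and B6: "B6 = 2*((x-1)*(x-2)*(x-3)*(x-4)*(x-5+5*t))*p - (x-4)*(x-5+2*t)*B5"
  shows "(x-2)*(x-3)*(x-4)*(((x+2*t)^2 - 2*(x+2*t) - 3*x)*((x-1)*(x-2+3*t)*p - 3*(x-1+2*t)*q))
   = B6 + 6*((x-3)*(x-4)*(x-5+3*t))*B4 - 18*((x-2)*(x-3)*(x-4)*(x-5+4*t))*q"
  unfolding B6 B5 B4 by algebra

lemma elimination_degree_8:
  fixes x t p q :: complex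
  assumes B4: "B4 = (x-1)*(x-2)*(x-3+3*t)*p - 3*((x-2)*(x-3+2*t))*q"
   and B5: "B5 = (x-1)*(x-2)*(x-3)*(x-4+4*t)*p - (x-3)*(x-4+2*t)*B4"
   and B6: "B6 = 2*((x-1)*(x-2)*(x-3)*(x-4)*(x-5+5*t))*p - (x-4)*(x-5+2*t)*B5"
  shows "(x - 2) * (x - 3) * (x - 4) * (x - 5) * (x - 6)
          * ((3 * x * (x - 1) - (2 * x + 6 * t - 5) * ((x+2*t)^2 - 2*(x+2*t) - 3*x)) * ((x-1)*(x-2+3*t)*p - 3*(x-1+2*t)*q))
   = 36*((x-2)*(x-3)*(x-4)*(x-5)*(x-6)*(x-7+6*t))*q - 2*((x-5)*(x-6)*(x-7+3*t))*B6
    - 36*((x-3)*(x-4)*(x-5)*(x-6)*(x-7+5*t))*B4 + 18*((x-4)*(x-5)*(x-6)*(x-7+4*t))*B5"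
  unfolding B6 B5 B4 by algebra

text \<open>The quotient of consecutive binomial coefficients splits off a linear factor. Polynomial
  formulas in \<open>y\<close> turn the relations into identities for
  \<open>algebra\<close>.\<close>

lemma wt_factored:
  fixes k :: nat
  defines "y \<equiv> of_nat k :: complex"
  shows "wt t k 2 = y * (y - 1 + 2 * t) / 2"
    and "wt t k 3 = y * (y - 1) * (y - 2 + 3 * t) / 6"
    and "wt t k 4 = y * (y - 1) * (y - 2) * (y - 3 + 4 * t) / 24"
    and "wt t k 5 = y * (y - 1) * (y - 2) * (y - 3) * (y - 4 + 5 * t) / 120"
    and "wt t k 6 = y * (y - 1) * (y - 2) * (y - 3) * (y - 4) * (y - 5 + 6 * t) / 720"
proof -
  have step: "(y gchoose Suc i) + t * (y gchoose i) = (y gchoose i) * ((y - of_nat i) + of_nat (Suc i) * t) / of_nat (Suc i)" for i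
    using gbinomial_mult_1[of y i] by (simp add: divide_simps del: of_nat_Suc) (simp add: algebra_simps)
  have g: "y gchoose 2 = y * (y - 1) / 2" "y gchoose 3 = y * (y - 1) * (y - 2) / 6"
    "y gchoose 4 = y * (y - 1) * (y - 2) * (y - 3) / 24"
    "y gchoose 5 = y * (y - 1) * (y - 2) * (y - 3) * (y - 4) / 120"
    by (simp_all add: gbinomial_prod_rev numeral_eq_Suc atLeast0_lessThan_Suc mult.assoc)
  show "wt t k 2 = y * (y - 1 + 2 * t) / 2"
    unfolding wt_def binomial_gbinomial y_def[symmetric] by (simp add: g field_simps)
  show "wt t k 3 = y * (y - 1) * (y - 2 + 3 * t) / 6"
    and "wt t k 4 = y * (y - 1) * (y - 2) * (y - 3 + 4 * t) / 24"
    and "wt t k 5 = y * (y - 1) * (y - 2) * (y - 3) * (y - 4 + 5 * t) / 120"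
    and "wt t k 6 = y * (y - 1) * (y - 2) * (y - 3) * (y - 4) * (y - 5 + 6 * t) / 720"
    unfolding wt_def binomial_gbinomial y_def[symmetric]
    using step[of 2] step[of 3] step[of 4] step[of 5]
    by (simp_all add: g)
qed

text \<open>\<open>\<Delta> = 0\<close> says that \<open>(a\<^sub>2, a\<^sub>3)\<close> is proportional to the same coefficients of the coboundary of \<open>D\<^sup>n\<close>.\<close>

lemma homog_relations:
  fixes n :: nat and t :: complex
  assumes "cocycle \<alpha> t G" and "n \<ge> 5"
  defines "x \<equiv> of_nat n"
  defines "\<Delta> \<equiv> (x - 1) * (x - 2 + 3 * t) * cf G 2 (n - 1) - 3 * (x - 1 + 2 * t) * cf G 3 (n - 2)"
  shows "((x + 2 * t)^2 - 2 * (x + 2 * t) - 3 * x) * \<Delta> = 0"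
    and "n \<ge> 7 \<Longrightarrow> \<Delta> = 0"
proof -
  \<comment> \<open>The factorial clears denominators, and the offset \<open>k\<close> replaces
    natural subtraction by polynomials in \<open>x\<close>.\<close>
  define v where "v = (\<lambda>i k. fact i * wt t (n - k) i)"
  have v2: "v 2 k = (x - of_nat k) * (x - of_nat (k + 1) + 2 * t)"
   and v3: "v 3 k = (x - of_nat k) * (x - of_nat (k + 1)) * (x - of_nat (k + 2) + 3 * t)"
   and v4: "v 4 k = (x - of_nat k) * (x - of_nat (k + 1)) * (x - of_nat (k + 2)) * (x - of_nat (k + 3) + 4 * t)"
   and v5: "v 5 k = (x - of_nat k) * (x - of_nat (k + 1)) * (x - of_nat (k + 2)) * (x - of_nat (k + 3))
      * (x - of_nat (k + 4) + 5 * t)"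
   and v6: "v 6 k = (x - of_nat k) * (x - of_nat (k + 1)) * (x - of_nat (k + 2)) * (x - of_nat (k + 3))
      * (x - of_nat (k + 4)) * (x - of_nat (k + 5) + 6 * t)" if "k \<le> n" for k
    using that by (simp_all add: v_def wt_factored x_def of_nat_diff fact_numeral diff_diff_eq add.commute)
  have w: "wt t (n - k) i = v i k / fact i" for i k
    by (simp add: v_def)
  have b: "4 choose 2 = (6::nat)" "4 choose 1 = (4::nat)" "5 choose 2 = (10::nat)" "5 choose 1 = (5::nat)"
    "6 choose 2 = (15::nat)" "6 choose 1 = (6::nat)" "6 choose 3 = (20::nat)" "8 choose 3 = (56::nat)"
    "8 choose 2 = (28::nat)" "8 choose 4 = (70::nat)"
    by (simp_all add: numeral_eq_Suc)
  define a where "a = (\<lambda>i. cf G i (n + 1 - i))"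
  have \<Delta>: "\<Delta> = (x - 1) * (x - 2 + 3 * t) * a 2 - 3 * (x - 1 + 2 * t) * a 3"
    using assms(2) by (simp add: \<Delta>_def a_def numeral_eq_Suc)
  have E: "wt t (n - (j - 1)) i * a j - wt t (n - (i - 1)) j * a i
      = (of_nat (i + j - 1 choose j) - of_nat (i + j - 1 choose (j - 1))) * a (i + j - 1)"
    if "i \<ge> 2" "j \<ge> 2" "i + j \<le> n + 2" for i j
  proof -
    have "n - (j - 1) = n + 1 - j" "n - (i - 1) = n + 1 - i" "n + 1 - (i + j - 1) = n + 2 - (i + j)"
      using that by auto
    then show ?thesis
      using homog_coeff[OF assms(1) that] by (simp only: a_def)
  qed
  have e32: "12 * a 4 = v 3 1 * a 2 - 3 * v 2 2 * a 3"
    using E[of 3 2] assms(2) by (simp add: w b fact_numeral field_simps)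
  have e42: "120 * a 5 = v 4 1 * a 2 - v 2 3 * (12 * a 4)"
    using E[of 4 2] assms(2) by (simp add: w b fact_numeral field_simps)
  have e52: "2160 * a 6 = 2 * v 5 1 * a 2 - v 2 4 * (120 * a 5)"
    using E[of 5 2] assms(2) by (simp add: w b fact_numeral field_simps)
  have e43: "2160 * a 6 + 6 * v 3 3 * (12 * a 4) - 18 * v 4 2 * a 3 = 0"
  proof -
    have "v 4 2 * a 3 = 120 * a 6 + 4 * (v 3 3 * a 4)"
      using E[of 4 3] assms(2) by (simp add: w b fact_numeral field_simps)
    then show ?thesis
      by algebra
  qed
  have nz: "x - of_nat k \<noteq> 0" if "k < n" for k
    using that by (simp add: x_def)
  let ?A = "(x + 2 * t)^2 - 2 * (x + 2 * t) - 3 * x"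
  have "(x - 2) * (x - 3) * (x - 4) * (?A * \<Delta>) = 0"
    using elimination_degree_6[of "12 * a 4" x t "a 2" "a 3" "120 * a 5" "2160 * a 6"] e32 e42 e52 e43 assms(2)
    by (simp add: v2 v3 v4 v5 \<Delta>)
  with nz[of 2] nz[of 3] nz[of 4] assms(2) show A: "?A * \<Delta> = 0"
    by simp
  show "\<Delta> = 0" if "n \<ge> 7"
  proof -
    have e63: "v 6 2 * a 3 - 120 * v 3 5 * a 6 = 20160 * a 8"
      using E[of 6 3] that by (simp add: w b fact_numeral field_simps)
    have e54: "v 5 3 * a 4 - 5 * v 4 4 * a 5 = 1680 * a 8"
      using E[of 5 4] that by (simp add: w b fact_numeral field_simps)
    \<comment> \<open>36 times \<open>e63\<close> minus 432 times \<open>e54\<close> eliminates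
      \<open>a 8\<close>; \<open>e63\<close> and \<open>e54\<close> are available because
      \<open>n \<ge> 7\<close>.\<close>
    have "36 * v 6 2 * a 3 - 2 * v 3 5 * (2160 * a 6) - 36 * v 5 3 * (12 * a 4) + 18 * v 4 4 * (120 * a 5) = 0"
      using e63 e54 by algebra
    then have "(x - 2) * (x - 3) * (x - 4) * (x - 5) * (x - 6)
        * ((3 * x * (x - 1) - (2 * x + 6 * t - 5) * ?A) * \<Delta>) = 0"
      using elimination_degree_8[of "12 * a 4" x t "a 2" "a 3" "120 * a 5" "2160 * a 6"] e32 e42 e52 that
      by (simp add: v2 v3 v4 v5 v6 \<Delta>)
    then have "(3 * x * (x - 1) - (2 * x + 6 * t - 5) * ?A) * \<Delta> = 0"
      using nz[of 2] nz[of 3] nz[of 4] nz[of 5] nz[of 6] that by simp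
    \<comment> \<open>The part containing \<open>?A\<close> vanishes by \<open>A\<close>, and what
      is left has a nonzero factor.\<close>
    then have "3 * x * (x - 1) * \<Delta> = 0"
      using A by algebra
    then show ?thesis
      using nz[of 0] nz[of 1] that by simp
  qed
qed

section \<open>Normal forms\<close>

definition bimonom :: "complex \<Rightarrow> nat \<Rightarrow> nat \<Rightarrow> complex poly poly" where
  "bimonom c i m = monom (monom c m) i"

lemma ev2_bimonom [simp]: "ev2 (bimonom c i m) D l = c * D ^ m * l ^ i"
  by (simp add: ev2_def bimonom_def poly_monom)

lemma cf_bimonom [simp]: "cf (bimonom c i m) i' m' = (if i' = i \<and> m' = m then c else 0)"
  by (auto simp: bimonom_def)

section \<open>Cocycle identities for the listed polynomials\<close>

lemma cocycle_linear:
  assumes "\<And>D l. ev2 F D l = a0 + a1 * l"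
  shows "cocycle \<alpha> \<alpha> F"
  unfolding cocycle_def assms by algebra

lemma cocycle_2:
  assumes "\<And>D l. ev2 F D l = c * l^2 * (2 * D + l)"
  shows "cocycle (t + 2) t F"
  unfolding cocycle_def assms by algebra

lemma cocycle_3:
  assumes "\<And>D l. ev2 F D l = c * D * l^2 * (D + l)"
  shows "cocycle (t + 3) t F"
  unfolding cocycle_def assms by algebra

lemma cocycle_4:
  assumes "\<And>D l. ev2 F D l = c * l^2 * (4*D^3 + 6*D^2*l - D*l^2 + t*l^3)"
  shows "cocycle (t + 4) t F"
  unfolding cocycle_def assms by algebra

lemma cocycle_5:
  assumes "\<And>D l. ev2 F D l = c * (D^4*l^2 - 10*D^2*l^4 - 17*D*l^5 - 8*l^6)"
  shows "cocycle 1 (-4) F"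
  unfolding cocycle_def assms by algebra

text \<open>The defect in the cocycle identity is the quadratic in \<open>t\<close> times an
  explicit polynomial. The factor 28 clears the denominator of \<open>9/28\<close>.\<close>

lemma cocycle_6:
  assumes "\<And>D l. ev2 F D l = c * (D^4*l^3 - (2*t + 3)*D^3*l^4 - 3*t*D^2*l^5
                                       - (3*t + 1)*D*l^6 - (t + 9/28)*l^7)"
    and t: "2 * t^2 + 10 * t + 3 = 0"
  shows "cocycle (t + 6) t F"
proof -
  have F: "28 * ev2 F D l = c * (28*D^4*l^3 - 28*(2*t + 3)*D^3*l^4 - 84*t*D^2*l^5
                                       - 28*(3*t + 1)*D*l^6 - (28 * t + 9)*l^7)" for D l
    unfolding assms(1) by (simp add: field_simps)
  show ?thesis
    unfolding cocycle_def
  proof (intro allI)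
    fix D l m
    have "28 * ((D + l + (t + 6) * m) * ev2 F D l + (D + t * l) * ev2 F (D + l) m
        - (D + m + (t + 6) * l) * ev2 F D m - (D + t * m) * ev2 F (D + m) l
        - (l - m) * ev2 F D (l + m))
      = (D + l + (t + 6) * m) * (28 * ev2 F D l) + (D + t * l) * (28 * ev2 F (D + l) m)
        - (D + m + (t + 6) * l) * (28 * ev2 F D m) - (D + t * m) * (28 * ev2 F (D + m) l)
        - (l - m) * (28 * ev2 F D (l + m))"
      by algebra
    also have "\<dots> = c * (2 * t^2 + 10 * t + 3) * 42 * (2 * D^2 * l^4 * m^2 - 2 * D^2 * l^2 * m^4
        + 2 * D * l^5 * m^2 + 2 * D * l^4 * m^3 - 2 * D * l^3 * m^4 - 2 * D * l^2 * m^5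
        + l^6 * m^2 + l^5 * m^3 - l^3 * m^5 - l^2 * m^6)"
      unfolding F by algebra
    also have "\<dots> = 0"
      using t by simp
    finally have "(D + l + (t + 6) * m) * ev2 F D l + (D + t * l) * ev2 F (D + l) m
        - (D + m + (t + 6) * l) * ev2 F D m - (D + t * m) * ev2 F (D + m) l
        - (l - m) * ev2 F D (l + m) = 0"
      by (simp only: mult_eq_0_iff) simp
    then show "(D + l + (t + 6) * m) * ev2 F D l + (D + t * l) * ev2 F (D + l) m
        - (D + m + (t + 6) * l) * ev2 F D m - (D + t * m) * ev2 F (D + m) l
        = (l - m) * ev2 F D (l + m)"
      by simp
  qed
qed

text \<open>Both claims come from (2t + 5)^2 = 19. The quantity \<open>15 + 6 * t\<close> is
  \<open>wt t 6 2\<close>, the \<lambda>^2-coefficient of the coboundary of D^6.\<close>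

lemma sqrt19_parameter:
  fixes t s :: complex
  assumes "s = 1 \<or> s = -1" "t = -5/2 + s * complex_of_real (sqrt 19) / 2"
  shows "2 * t^2 + 10 * t + 3 = 0" "15 + 6 * t \<noteq> 0"
proof -
  have r: "complex_of_real (sqrt 19) ^ 2 = 19"
    by (simp flip: of_real_power)
  have "s^2 = 1"
    using assms(1) by auto
  have t: "2 * t + 5 = s * complex_of_real (sqrt 19)"
    unfolding assms(2) by (simp add: algebra_simps)
  then have sq: "(2 * t + 5)^2 = 19"
    using r \<open>s^2 = 1\<close> by (simp add: power_mult_distrib)
  then have "2 * (2 * t^2 + 10 * t + 3) = 0"
    by (simp add: power2_eq_square algebra_simps)
  then show "2 * t^2 + 10 * t + 3 = 0"
    by (simp only: mult_eq_0_iff) simp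
  have "15 + 6 * t = 3 * (2 * t + 5)"
    by simp
  moreover have "2 * t + 5 \<noteq> 0"
    using sq by auto
  ultimately show "15 + 6 * t \<noteq> 0"
    by (simp only: mult_eq_0_iff) simp
qed

lemma sqrt19_parameterI:
  fixes t :: complex
  assumes "2 * t^2 + 10 * t + 3 = 0"
  shows "\<exists>s. (s = 1 \<or> s = -1) \<and> t = -5/2 + s * complex_of_real (sqrt 19) / 2"
proof -
  have r: "complex_of_real (sqrt 19) ^ 2 = 19"
    by (simp flip: of_real_power)
  have "(2 * t + 5)^2 = complex_of_real (sqrt 19) ^ 2"
    unfolding r using assms by algebra
  then have "2 * t + 5 = complex_of_real (sqrt 19) \<or> 2 * t + 5 = - complex_of_real (sqrt 19)"
    by (simp only: power2_eq_iff)
  then show ?thesis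
  proof
    assume "2 * t + 5 = complex_of_real (sqrt 19)"
    then show ?thesis
      by (intro exI[of _ 1]) (auto simp: field_simps)
  next
    assume "2 * t + 5 = - complex_of_real (sqrt 19)"
    then show ?thesis
      by (intro exI[of _ "-1"]) (auto simp: field_simps eq_neg_iff_add_eq_0)
  qed
qed

lemma normal_form_shift2: "normal_form \<alpha> \<alpha>' \<beta> (shift2 \<beta> F) \<longleftrightarrow> normal_form \<alpha> \<alpha>' 0 F"
proof -
  have "(\<forall>d l. ev2 F (d + \<beta>) l = P (d + \<beta>) l) \<longleftrightarrow> (\<forall>d l. ev2 F d l = P d l)" for P
    by (metis diff_add_cancel)
  note * = this[of "\<lambda>D l. a0 + a1 * l" for a0 a1]
    this[of "\<lambda>D l. c * l^2 * (2*D + l)" for c]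
    this[of "\<lambda>D l. c * D * l^2 * (D + l)" for c]
    this[of "\<lambda>D l. c * l^2 * (4*D^3 + 6*D^2*l - D*l^2 + \<alpha>'*l^3)" for c]
    this[of "\<lambda>D l. c * (D^4*l^2 - 10*D^2*l^4 - 17*D*l^5 - 8*l^6)" for c]
    this[of "\<lambda>D l. c * (D^4*l^3 - (2*\<alpha>' + 3)*D^3*l^4 - 3*\<alpha>'*D^2*l^5
                                       - (3*\<alpha>' + 1)*D*l^6 - (\<alpha>' + 9/28)*l^7)" for c]
  show ?thesis
    unfolding normal_form_def ev2_shift2 * add_0_right ..
qed

lemma normal_form_cocycle:
  assumes "normal_form \<alpha> \<alpha>' 0 F"
  shows "cocycle \<alpha> \<alpha>' F"
proof -
  have \<alpha>: "\<alpha> - \<alpha>' = k \<Longrightarrow> \<alpha> = \<alpha>' + k" for k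
    by (simp add: algebra_simps)
  from assms show ?thesis
    unfolding normal_form_def add_0_right
  proof (elim disjE conjE exE, goal_cases)
    case 1 then show ?case using cocycle_linear by metis
  next
    case 2 then show ?case using cocycle_2 \<alpha> by metis
  next
    case 3 then show ?case using cocycle_3 \<alpha> by metis
  next
    case 4 then show ?case using cocycle_4 \<alpha> by metis
  next
    case 5 then show ?case using cocycle_5 by metis
  next
    \<comment> \<open>Cases 6 and 7 are the two signs \<open>s = 1\<close> and
      \<open>s = -1\<close>.\<close>
    case (6 s c)
    have "\<alpha> = \<alpha>' + 6" using 6 by simp
    then show ?case using cocycle_6[of F c \<alpha>'] 6 sqrt19_parameter(1)[of s \<alpha>'] by simp
  next
    case (7 s c)
    have "\<alpha> = \<alpha>' + 6" using 7 by simp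
    then show ?case using cocycle_6[of F c \<alpha>'] 7 sqrt19_parameter(1)[of s \<alpha>'] by simp
  qed
qed

section \<open>Nontriviality of the normal forms\<close>

lemma wt_numeral:
  "wt t 2 2 = 1 + 2 * t" "wt t 2 3 = t" "wt t 3 2 = 3 + 3 * t" "wt t 3 3 = 1 + 3 * t"
  "wt t 4 2 = 6 + 4 * t" "wt t 4 3 = 4 + 6 * t" "wt t 5 2 = 10 + 5 * t" "wt t 5 3 = 10 + 10 * t"
  "wt t 6 2 = 15 + 6 * t"
  by (simp_all add: wt_def numeral_eq_Suc)

lemma cf_cobd_2: "cf (cobd \<alpha> t Q) 2 m = wt t (m + 1) 2 * coeff Q (m + 1)"
  using cf_cobd[of \<alpha> t Q 1 m] by (simp add: numeral_2_eq_2)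

lemma cf_cobd_3: "cf (cobd \<alpha> t Q) 3 m = wt t (m + 2) 3 * coeff Q (m + 2)"
  using cf_cobd[of \<alpha> t Q 2 m] by (simp add: numeral_3_eq_3)

text \<open>Except for \<open>\<alpha> = \<alpha>'\<close>, only the coefficients at \<open>\<lambda>\<^sup>2\<close> and \<open>\<lambda>\<^sup>3\<close> matter: they are not proportional to those of a coboundary.\<close>

lemma normal_form_not_cobd:
  assumes "normal_form \<alpha> t 0 F"
  shows "F \<noteq> cobd \<alpha> t Q"
proof
  assume FQ: "F = cobd \<alpha> t Q"
  have cf2: "cf F 2 m = wt t (m + 1) 2 * coeff Q (m + 1)" and
    cf3: "cf F 3 m = wt t (m + 2) 3 * coeff Q (m + 2)" for m
    unfolding FQ by (rule cf_cobd_2 cf_cobd_3)+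
  have last: False if "\<And>d l. ev2 F d l = c * (d^4*l^3 - (2*t + 3)*d^3*l^4 - 3*t*d^2*l^5
                                       - (3*t + 1)*d*l^6 - (t + 9/28)*l^7)" "c \<noteq> 0" "15 + 6 * t \<noteq> 0" for c
  proof -
    have F: "F = bimonom c 3 4 + bimonom (- c * (2*t + 3)) 4 3 + bimonom (- c * (3*t)) 5 2
        + bimonom (- c * (3*t + 1)) 6 1 + bimonom (- c * (t + 9/28)) 7 0"
      by (rule ev2_inject) (simp add: that(1) algebra_simps)
    have "(15 + 6 * t) * coeff Q 6 = 0"
      using cf2[of 5] by (simp add: F wt_numeral)
    then show False
      using cf3[of 4] that by (simp add: F)
  qed
  from assms show False
    unfolding normal_form_def add_0_right
  proof (elim disjE conjE exE, goal_cases)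
    case (1 a0 a1)
    have F: "F = bimonom a0 0 0 + bimonom a1 1 0"
      by (rule ev2_inject) (simp add: 1)
    have "cf F 0 0 = 0"
      by (simp add: FQ cf_cobd_0)
    moreover have "cf F (Suc 0) 0 = 0"
      using 1(1) cf_cobd[of \<alpha> t Q 0 0] by (simp add: FQ wt_def)
    ultimately show ?case
      using 1(2) by (simp add: F)
  next
    case (2 c)
    have F: "F = bimonom (2 * c) 2 1 + bimonom c 3 0"
      by (rule ev2_inject) (simp add: 2 algebra_simps power2_eq_square power3_eq_cube)
    have "2 * c = (1 + 2 * t) * coeff Q 2" "c = t * coeff Q 2"
      using cf2[of 1, unfolded one_add_one] cf3[of 0, unfolded add_0] by (simp_all add: F wt_numeral)
    \<comment> \<open>Eliminating \<open>c\<close> leaves a nonzero constant times the coefficient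
      of \<open>Q\<close>, free of \<open>t\<close>: here 1, and in the next two cases 2 and
      20.\<close>
    then have "c = 0" by algebra
    with 2 show ?case by simp
  next
    case (3 c)
    have F: "F = bimonom c 2 2 + bimonom c 3 1"
      by (rule ev2_inject) (simp add: 3 algebra_simps power2_eq_square power3_eq_cube)
    have "c = (3 + 3 * t) * coeff Q 3" "c = (1 + 3 * t) * coeff Q 3"
      using cf2[of 2] cf3[of 1] by (simp_all add: F wt_numeral flip: numeral_3_eq_3)
    then have "c = 0" by algebra
    with 3 show ?case by simp
  next
    case (4 c)
    have F: "F = bimonom (4 * c) 2 3 + bimonom (6 * c) 3 2 + bimonom (- c) 4 1 + bimonom (c * t) 5 0"
      by (rule ev2_inject) (simp add: 4 algebra_simps power_numeral_reduce)
    have "4 * c = (6 + 4 * t) * coeff Q 4" "6 * c = (4 + 6 * t) * coeff Q 4"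
      using cf2[of 3] cf3[of 2] by (simp_all add: F wt_numeral)
    then have "c = 0" by algebra
    with 4 show ?case by simp
  next
    case (5 c)
    have F: "F = bimonom c 2 4 + bimonom (- 10 * c) 4 2 + bimonom (- 17 * c) 5 1 + bimonom (- 8 * c) 6 0"
      by (rule ev2_inject) (simp add: 5 algebra_simps)
    \<comment> \<open>\<open>F\<close> has no \<lambda>^3-term, while
      \<open>wt (-4) 5 3 = -30\<close>.\<close>
    have "coeff Q 5 = 0"
      using cf3[of 3] 5 by (simp add: F wt_numeral)
    with 5 cf2[of 4] show ?case
      by (simp add: F)
  next
    case (6 s c)
    then show ?case
      using last sqrt19_parameter(2)[of s t] by blast
  next
    case (7 s c)
    then show ?case
      using last sqrt19_parameter(2)[of s t] by blast
  qed
qed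

section \<open>Classification of cocycles modulo coboundaries\<close>

lemma homog_add: "homog n F \<Longrightarrow> homog n G \<Longrightarrow> homog n (F + G)"
  unfolding homog_def coeff_add by (metis add_0_right)

lemma homog_bimonom: "i \<ge> 2 \<Longrightarrow> m + i = Suc n \<Longrightarrow> homog n (bimonom c i m)"
  by (auto simp: homog_def)

lemma cobd_add: "cobd \<alpha> t (P + Q) = cobd \<alpha> t P + cobd \<alpha> t Q"
  by (rule ev2_inject) (simp add: algebra_simps)

text \<open>For each \<open>n\<close> it suffices to match the \<lambda>^2- and
  \<lambda>^3-coefficients, which is a linear system for \<open>q\<close> and the scalar
  \<open>c\<close> of the normal form.\<close>

lemma homog_classification:
  assumes G: "cocycle \<alpha> t G" "homog n G" and n: "\<alpha> - t = of_nat n" "n > 0" and "t \<noteq> 0"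
  shows "\<exists>q N. G = N + cobd \<alpha> t (monom q n) \<and> (N = 0 \<or> normal_form \<alpha> t 0 N)"
proof -
  have zero: ?thesis
    if "(of_nat n - 1) * (of_nat n - 2 + 3 * t) * cf G 2 (n - 1)
      - 3 * (of_nat n - 1 + 2 * t) * cf G 3 (n - 2) = 0" "n \<ge> 2"
  proof -
    define x where "x = (of_nat n :: complex)"
    have x: "x \<noteq> 0" "x \<noteq> 1" "x + 1 \<noteq> 0"
      using n(2) that(2) of_nat_neq_0[of n] by (auto simp: x_def add.commute)
    have w2: "wt t n 2 = x * (x - 1 + 2 * t) / 2"
      and w3: "wt t n 3 = x * (x - 1) * (x - 2 + 3 * t) / 6"
      by (simp_all add: wt_factored x_def)
    have "wt t n 3 * cf G 2 (n - 1) = wt t n 2 * cf G 3 (n - 2)"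
    proof -
      have "(x - 1) * (x - 2 + 3 * t) * cf G 2 (n - 1) = 3 * (x - 1 + 2 * t) * cf G 3 (n - 2)"
        using that(1) by (simp add: x_def)
      moreover have "6 * wt t n 3 = x * ((x - 1) * (x - 2 + 3 * t))" "2 * wt t n 2 = x * (x - 1 + 2 * t)"
        by (simp_all add: w2 w3)
      ultimately have "6 * (wt t n 3 * cf G 2 (n - 1)) = 6 * (wt t n 2 * cf G 3 (n - 2))"
        by algebra
      then show ?thesis
        by (simp only: mult_cancel_left) simp
    qed
    moreover have "wt t n 2 \<noteq> 0 \<or> wt t n 3 \<noteq> 0"
    proof (rule ccontr)
      assume "\<not> ?thesis"
      then have "x - 1 + 2 * t = 0" "x - 2 + 3 * t = 0"
        using x by (auto simp: w2 w3)
      \<comment> \<open>Three times the first equation minus twice the second.\<close>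
      then have "x + 1 = 0" by algebra
      then show False
        using x(3) by simp
    qed
    ultimately obtain q where "cf G 2 (n - 1) = q * wt t n 2" "cf G 3 (n - 2) = q * wt t n 3"
      by (cases "wt t n 2 = 0") (auto simp: field_simps
           intro: that[of "cf G 2 (n - 1) / wt t n 2"] that[of "cf G 3 (n - 2) / wt t n 3"])
    then have "G = 0 + cobd \<alpha> t (monom q n)"
      using assms by (intro homog_cocycle_eqI) (auto simp: cocycle_def homog_def)
    then show ?thesis
      by blast
  qed
  have nf: ?thesis
    if "cocycle \<alpha> t N" "homog n N" "c \<noteq> 0 \<Longrightarrow> normal_form \<alpha> t 0 N" "c = 0 \<Longrightarrow> N = 0" "n \<ge> 2"
      "cf G 2 (n - 1) = cf N 2 (n - 1) + q * wt t n 2" "cf G 3 (n - 2) = cf N 3 (n - 2) + q * wt t n 3" for c N q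
    using homog_cocycle_eqI[OF G that(1,2) n(1) that(6,7) n(2)] that(3,4) by blast
  have \<alpha>: "\<alpha> = t + of_nat n"
    using n(1) by (simp add: algebra_simps)
  consider "n = 1" | "n = 2" | "n = 3" | "n = 4" | "n = 5" | "n = 6" | "n \<ge> 7"
    using n(2) by linarith
  then show ?thesis
  proof cases
    case 1
    \<comment> \<open>Only \<lambda>^2 occurs for \<open>n = 1\<close>, and
      \<open>wt t 1 2 = t\<close> is nonzero.\<close>
    have "G = 0 + cobd \<alpha> t (monom (cf G 2 (n - 1) / t) n)"
      using assms 1 by (intro homog_cocycle_eqI) (auto simp: cocycle_def homog_def wt_def binomial_eq_0)
    then show ?thesis
      by blast
  next
    case 2
    \<comment> \<open>Here and for \<open>n = 3, 4\<close>, \<open>q\<close> results from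
      eliminating \<open>c\<close>; the divisors 1, 2, 20 are independent of
      \<open>t\<close>.\<close>
    define q where "q = cf G 2 1 - 2 * cf G 3 0"
    define c where "c = cf G 3 0 - q * t"
    define N where "N = bimonom (2 * c) 2 1 + bimonom c 3 0"
    have N: "ev2 N D l = c * l^2 * (2 * D + l)" for D l
      by (simp add: N_def algebra_simps power2_eq_square power3_eq_cube)
    show ?thesis
    proof (rule nf[of N c q])
      show "cocycle \<alpha> t N"
        using cocycle_2[OF N] by (simp add: \<alpha> 2)
      show "homog n N"
        unfolding N_def using 2 by (intro homog_add homog_bimonom) auto
      show "normal_form \<alpha> t 0 N" if "c \<noteq> 0"
        using that N by (auto simp: normal_form_def \<alpha> 2)
      show "N = 0" if "c = 0"
        using that by (intro ev2_inject) (simp add: N)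
      show "cf G 2 (n - 1) = cf N 2 (n - 1) + q * wt t n 2" "cf G 3 (n - 2) = cf N 3 (n - 2) + q * wt t n 3"
        by (simp_all add: 2 N_def wt_numeral c_def q_def algebra_simps)
    qed (use 2 in auto)
  next
    case 3
    define q where "q = (cf G 2 2 - cf G 3 1) / 2"
    define c where "c = cf G 2 2 - q * (3 + 3 * t)"
    define N where "N = bimonom c 2 2 + bimonom c 3 1"
    have N: "ev2 N D l = c * D * l^2 * (D + l)" for D l
      by (simp add: N_def algebra_simps power2_eq_square power3_eq_cube)
    show ?thesis
    proof (rule nf[of N c q])
      show "cocycle \<alpha> t N"
        using cocycle_3[OF N] by (simp add: \<alpha> 3)
      show "homog n N"
        unfolding N_def using 3 by (intro homog_add homog_bimonom) auto
      show "normal_form \<alpha> t 0 N" if "c \<noteq> 0"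
        using that N by (auto simp: normal_form_def \<alpha> 3)
      show "N = 0" if "c = 0"
        using that by (intro ev2_inject) (simp add: N)
      show "cf G 2 (n - 1) = cf N 2 (n - 1) + q * wt t n 2" "cf G 3 (n - 2) = cf N 3 (n - 2) + q * wt t n 3"
        by (simp_all add: 3 N_def wt_numeral c_def q_def field_simps)
    qed (use 3 in auto)
  next
    case 4
    define q where "q = (6 * cf G 2 3 - 4 * cf G 3 2) / 20"
    define c where "c = (cf G 2 3 - q * (6 + 4 * t)) / 4"
    define N where "N = bimonom (4 * c) 2 3 + bimonom (6 * c) 3 2 + bimonom (- c) 4 1 + bimonom (c * t) 5 0"
    have N: "ev2 N D l = c * l^2 * (4*D^3 + 6*D^2*l - D*l^2 + t*l^3)" for D l
      by (simp add: N_def algebra_simps power_numeral_reduce)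
    show ?thesis
    proof (rule nf[of N c q])
      show "cocycle \<alpha> t N"
        using cocycle_4[OF N] by (simp add: \<alpha> 4)
      show "homog n N"
        unfolding N_def using 4 by (intro homog_add homog_bimonom) auto
      show "normal_form \<alpha> t 0 N" if "c \<noteq> 0"
        using that N by (auto simp: normal_form_def \<alpha> 4)
      show "N = 0" if "c = 0"
        using that by (intro ev2_inject) (simp add: N)
      show "cf G 2 (n - 1) = cf N 2 (n - 1) + q * wt t n 2" "cf G 3 (n - 2) = cf N 3 (n - 2) + q * wt t n 3"
        by (simp_all add: 4 N_def wt_numeral c_def q_def field_simps)
    qed (use 4 in auto)
  next
    case 5
    show ?thesis
    proof (cases "t = -4")
      case True
      \<comment> \<open>\<open>N\<close> has no \<lambda>^3-term, so that coefficient alone fixes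
        \<open>q\<close>; \<open>wt (-4) 5 2 = -10\<close> then gives \<open>c\<close>.\<close>
      define q where "q = - cf G 3 3 / 30"
      define c where "c = cf G 2 4 + 10 * q"
      define N where "N = bimonom c 2 4 + bimonom (- 10 * c) 4 2 + bimonom (- 17 * c) 5 1 + bimonom (- 8 * c) 6 0"
      have N: "ev2 N D l = c * (D^4*l^2 - 10*D^2*l^4 - 17*D*l^5 - 8*l^6)" for D l
        by (simp add: N_def algebra_simps)
      show ?thesis
      proof (rule nf[of N c q])
        show "cocycle \<alpha> t N"
          using cocycle_5[OF N] by (simp add: \<alpha> 5 True)
        show "homog n N"
          unfolding N_def using 5 by (intro homog_add homog_bimonom) auto
        show "normal_form \<alpha> t 0 N" if "c \<noteq> 0"
          using that N by (auto simp: normal_form_def \<alpha> 5 True)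
        show "N = 0" if "c = 0"
          using that by (intro ev2_inject) (simp add: N)
        show "cf G 2 (n - 1) = cf N 2 (n - 1) + q * wt t n 2" "cf G 3 (n - 2) = cf N 3 (n - 2) + q * wt t n 3"
          by (simp_all add: 5 True N_def wt_numeral c_def q_def)
      qed (use 5 in auto)
    next
      case False
      \<comment> \<open>This expression equals 4 t (t + 4).\<close>
      then have "(5 + 2 * t)^2 - 2 * (5 + 2 * t) - 3 * 5 \<noteq> 0"
        using \<open>t \<noteq> 0\<close> by algebra
      then show ?thesis
        using homog_relations(1)[OF G(1), of n] 5 by (intro zero) simp_all
    qed
  next
    case 6
    show ?thesis
    proof (cases "2 * t^2 + 10 * t + 3 = 0")
      case True
      obtain s where s: "s = 1 \<or> s = -1" "t = -5/2 + s * complex_of_real (sqrt 19) / 2"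
        using sqrt19_parameterI[OF True] by blast
      have \<alpha>': "\<alpha> = 7/2 + s * complex_of_real (sqrt 19) / 2"
        by (simp add: \<alpha> 6 s(2))
      have w: "wt t n 2 \<noteq> 0"
      proof -
        have "wt t n 2 = 15 + 6 * t"
          by (simp add: 6 wt_numeral)
        then show ?thesis
          using sqrt19_parameter(2)[OF s] by simp
      qed
      \<comment> \<open>\<open>N\<close> has no \<lambda>^2-term, so that coefficient alone fixes
        \<open>q\<close>.\<close>
      define q where "q = cf G 2 5 / wt t n 2"
      define c where "c = cf G 3 4 - q * wt t n 3"
      define N where "N = bimonom c 3 4 + bimonom (- c * (2*t + 3)) 4 3 + bimonom (- c * (3*t)) 5 2
        + bimonom (- c * (3*t + 1)) 6 1 + bimonom (- c * (t + 9/28)) 7 0"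
      have N: "ev2 N D l = c * (D^4*l^3 - (2*t + 3)*D^3*l^4 - 3*t*D^2*l^5
          - (3*t + 1)*D*l^6 - (t + 9/28)*l^7)" for D l
        by (simp add: N_def algebra_simps)
      show ?thesis
      proof (rule nf[of N c q])
        show "cocycle \<alpha> t N"
          using cocycle_6[OF N True] by (simp add: \<alpha> 6)
        show "homog n N"
          unfolding N_def using 6 by (intro homog_add homog_bimonom) auto
        show "normal_form \<alpha> t 0 N" if "c \<noteq> 0"
          unfolding normal_form_def add_0_right using that N \<alpha>' s by blast
        show "N = 0" if "c = 0"
          using that by (intro ev2_inject) (simp add: N)
        show "cf G 2 (n - 1) = cf N 2 (n - 1) + q * wt t n 2" "cf G 3 (n - 2) = cf N 3 (n - 2) + q * wt t n 3"
          using w by (simp_all add: 6 N_def c_def q_def)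
      qed (use 6 in auto)
    next
      case False
      \<comment> \<open>This is twice the quadratic that is nonzero in this case.\<close>
      then have "(6 + 2 * t)^2 - 2 * (6 + 2 * t) - 3 * 6 \<noteq> 0"
        by algebra
      then show ?thesis
        using homog_relations(1)[OF G(1), of n] 6 by (intro zero) simp_all
    qed
  next
    case 7
    then show ?thesis
      using homog_relations(2)[OF G(1), of n] by (intro zero) simp_all
  qed
qed

lemma cocycle_classification:
  assumes "cocycle \<alpha> t F" and "t \<noteq> 0"
  obtains Q where "F = cobd \<alpha> t Q"
  | N Q where "normal_form \<alpha> t 0 N" "F = N + cobd \<alpha> t Q"
  using assms
proof (cases rule: cocycle_reduction)
  case (zero Q a0 a1)
  have ev: "ev2 [:[:a0:], [:a1:]:] D l = a0 + a1 * l" for D l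
    by (simp add: ev2_def)
  show ?thesis
  proof (cases "(a0, a1) = (0, 0)")
    case True
    then show ?thesis
      using that(1)[of Q] zero(2) by simp
  next
    case False
    then have "normal_form \<alpha> t 0 [:[:a0:], [:a1:]:]"
      using zero(1) ev unfolding normal_form_def by blast
    then show ?thesis
      using that(2) zero(2) by blast
  qed
next
  case (pos Q G n)
  obtain q N where "G = N + cobd \<alpha> t (monom q n)" "N = 0 \<or> normal_form \<alpha> t 0 N"
    using homog_classification[OF pos(5,4,1,2) assms(2)] by blast
  then show ?thesis
    using that(1)[of "monom q n + Q"] that(2)[of N "monom q n + Q"] pos(3)
    by (auto simp: cobd_add add.assoc)
qed (use that(1) in blast)

section \<open>Return from cocycles to extensions\<close>

text \<open>Replaces the parameter list of the theorem by existence of a normal form, the condition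
  that the nontriviality argument produces and consumes.\<close>

lemma normal_form_exists_iff:
  "(\<exists>N. normal_form \<alpha> \<alpha>' 0 N) \<longleftrightarrow>
     \<alpha> = \<alpha>' \<or> \<alpha> - \<alpha>' = 2 \<or> \<alpha> - \<alpha>' = 3 \<or> \<alpha> - \<alpha>' = 4 \<or> (\<alpha> = 1 \<and> \<alpha>' = -4)
       \<or> (\<exists>s::complex. (s = 1 \<or> s = -1) \<and>
            \<alpha> = 7/2 + s * complex_of_real (sqrt 19) / 2 \<and>
            \<alpha>' = -5/2 + s * complex_of_real (sqrt 19) / 2)" (is "_ \<longleftrightarrow> ?R")
proof
  show ?R if "\<exists>N. normal_form \<alpha> \<alpha>' 0 N"
    using that unfolding normal_form_def by meson
  assume ?R
  then show "\<exists>N. normal_form \<alpha> \<alpha>' 0 N"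
  proof (elim disjE, goal_cases)
    case 1
    have "ev2 [:[:1:], [:0:]:] D l = 1 + 0 * l" for D l
      by (simp add: ev2_def)
    then have "normal_form \<alpha> \<alpha>' 0 [:[:1:], [:0:]:]"
      unfolding normal_form_def using 1 by (metis prod.inject zero_neq_one)
    then show ?case ..
  next
    case 2
    have "normal_form \<alpha> \<alpha>' 0 (bimonom 2 2 1 + bimonom 1 3 0)"
      unfolding normal_form_def using 2
      by (intro disjI1[THEN disjI2] conjI exI[of _ 1])
        (simp_all add: algebra_simps power2_eq_square power3_eq_cube)
    then show ?case ..
  next
    case 3
    have "normal_form \<alpha> \<alpha>' 0 (bimonom 1 2 2 + bimonom 1 3 1)"
      unfolding normal_form_def using 3
      by (intro disjI1[THEN disjI2, THEN disjI2] conjI exI[of _ 1])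
        (simp_all add: algebra_simps power2_eq_square power3_eq_cube)
    then show ?case ..
  next
    case 4
    have "normal_form \<alpha> \<alpha>' 0 (bimonom 4 2 3 + bimonom 6 3 2 + bimonom (-1) 4 1 + bimonom \<alpha>' 5 0)"
      unfolding normal_form_def using 4
      by (intro disjI1[THEN disjI2, THEN disjI2, THEN disjI2] conjI exI[of _ 1])
        (simp_all add: algebra_simps power_numeral_reduce)
    then show ?case ..
  next
    case 5
    have "normal_form \<alpha> \<alpha>' 0
        (bimonom 1 2 4 + bimonom (-10) 4 2 + bimonom (-17) 5 1 + bimonom (-8) 6 0)"
      unfolding normal_form_def using 5
      by (intro disjI1[THEN disjI2, THEN disjI2, THEN disjI2, THEN disjI2] conjI exI[of _ 1])
        (simp_all add: algebra_simps)
    then show ?case ..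
  next
    case 6
    have "normal_form \<alpha> \<alpha>' 0
        (bimonom 1 3 4 + bimonom (- (2*\<alpha>' + 3)) 4 3 + bimonom (- (3*\<alpha>')) 5 2
          + bimonom (- (3*\<alpha>' + 1)) 6 1 + bimonom (- (\<alpha>' + 9/28)) 7 0)"
      unfolding normal_form_def
      by (rule disjI2[THEN disjI2, THEN disjI2, THEN disjI2, THEN disjI2], rule conjI, rule 6,
          rule exI[of _ 1]) (simp add: algebra_simps)
    then show ?case ..
  qed
qed

theorem theorem3p9:
  fixes a b \<alpha> \<alpha>' \<beta> :: complex
  assumes "b \<noteq> 0" and "\<alpha> \<noteq> 0" and "\<alpha>' \<noteq> 0"
  shows "(\<forall>f g. is_ext a b \<alpha> \<alpha>' \<beta> f g \<longrightarrow> g = 0)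
       \<and> ((\<exists>f g. is_ext a b \<alpha> \<alpha>' \<beta> f g \<and> \<not> ext_trivial \<alpha> \<alpha>' \<beta> f g) \<longleftrightarrow>
            (\<alpha> = \<alpha>' \<or> \<alpha> - \<alpha>' = 2 \<or> \<alpha> - \<alpha>' = 3 \<or> \<alpha> - \<alpha>' = 4 \<or> (\<alpha> = 1 \<and> \<alpha>' = -4)
             \<or> (\<exists>s::complex. (s = 1 \<or> s = -1) \<and>
                  \<alpha> = 7/2 + s * complex_of_real (sqrt 19) / 2 \<and>
                  \<alpha>' = -5/2 + s * complex_of_real (sqrt 19) / 2)))
       \<and> (\<forall>f g. is_ext a b \<alpha> \<alpha>' \<beta> f g \<and> \<not> ext_trivial \<alpha> \<alpha>' \<beta> f g \<longrightarrow>
            (\<exists>f'. is_ext a b \<alpha> \<alpha>' \<beta> f' 0 \<and> ext_equiv \<alpha> \<alpha>' \<beta> f g f' 0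
                  \<and> normal_form \<alpha> \<alpha>' \<beta> f'))"
proof -
  have g: "g = 0" if "is_ext a b \<alpha> \<alpha>' \<beta> f g" for f g
    using that is_ext_imp_g_eq_0 assms(1) by blast
  have unshift: "shift2 (-\<beta>) (shift2 \<beta> N) = N" for N
    by (rule ev2_inject) simp
  have nf_ext: "is_ext a b \<alpha> \<alpha>' \<beta> (shift2 \<beta> N) 0" "\<not> ext_trivial \<alpha> \<alpha>' \<beta> (shift2 \<beta> N) 0"
    if N: "normal_form \<alpha> \<alpha>' 0 N" for N
  proof -
    show "is_ext a b \<alpha> \<alpha>' \<beta> (shift2 \<beta> N) 0"
      using normal_form_cocycle[OF N] by (simp add: is_ext_iff_cocycle unshift)
    show "\<not> ext_trivial \<alpha> \<alpha>' \<beta> (shift2 \<beta> N) 0"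
      using normal_form_not_cobd[OF N] by (metis ext_trivial_imp_cobd unshift)
  qed
  have red: "\<exists>N. normal_form \<alpha> \<alpha>' 0 N \<and> ext_equiv \<alpha> \<alpha>' \<beta> f 0 (shift2 \<beta> N) 0"
    if "is_ext a b \<alpha> \<alpha>' \<beta> f 0" "\<not> ext_trivial \<alpha> \<alpha>' \<beta> f 0" for f
    using that(1)[unfolded is_ext_iff_cocycle] assms(3)
  proof (cases rule: cocycle_classification)
    case (1 Q)
    then have "ext_equiv \<alpha> \<alpha>' \<beta> f 0 (shift2 \<beta> 0) 0"
      by (intro ext_equiv_cobd) simp
    moreover have "shift2 \<beta> 0 = 0"
      by (simp add: shift2_def)
    ultimately show ?thesis
      using that(2) by (simp add: ext_trivial_def)
  next
    case (2 N Q)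
    then show ?thesis
      by (intro exI[of _ N] conjI ext_equiv_cobd[of _ _ _ _ _ Q])
  qed
  show ?thesis
    unfolding normal_form_exists_iff[symmetric]
  proof (intro conjI allI impI iffI, goal_cases)
    case (1 f g)
    then show ?case
      by (rule g)
  next
    case 2
    then obtain f g' where f: "is_ext a b \<alpha> \<alpha>' \<beta> f g'" "\<not> ext_trivial \<alpha> \<alpha>' \<beta> f g'"
      by (elim exE conjE)
    then show ?case
      using red[of f] g[OF f(1)] by auto
  next
    case 3
    then obtain N where "normal_form \<alpha> \<alpha>' 0 N" ..
    from nf_ext[OF this] show ?case
      by (intro exI conjI)
  next
    case (4 f g')
    then have "g' = 0"
      using g by (elim conjE)
    with 4 red[of f] obtain N
      where N: "normal_form \<alpha> \<alpha>' 0 N" "ext_equiv \<alpha> \<alpha>' \<beta> f g' (shift2 \<beta> N) 0"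
      by auto
    then show ?case
      by (intro exI[of _ "shift2 \<beta> N"] conjI nf_ext(1)) (simp_all add: normal_form_shift2)
  qed
qed

end
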